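(* For every real $\varepsilon>0$ there exists an integer $n_0\ge 2$ such that for all integers $n\ge n_0$ the following holds. Let $m=2^{n-1}$ and let $\mathbf{d}_1,\mathbf{d}_2,\dots,\mathbf{d}_m\in\mathbb{F}_2^n$ be nonzero vectors (not necessarily distinct) with $\sum_{i=1}^m\mathbf{d}_i=\mathbf{0}$, such that at least a fraction $\frac12+\varepsilon$ of them are all equal, i.e. there is a vector $\mathbf{u}$ with $|\{i\in\{1,\dots,m\}:\mathbf{d}_i=\mathbf{u}\}|\ge\left(\frac12+\varepsilon\right)m$. Then $\mathbb{F}_2^n$ can be partitioned into pairwise disjoint pairs $\{\mathbf{a}_i,\mathbf{b}_i\}$ ($1\le i\le m$) such that $\mathbf{a}_i-\mathbf{b}_i=\mathbf{d}_i$ for every $1\le i\le m$.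
   Context: $\mathbb{F}_2^n$ denotes the $n$-dimensional vector space over the two-element field $\mathbb{F}_2$. *)

theory Defs
  imports
    Complex_Main
    "HOL-Library.Z2"
    "HOL-Library.Disjoint_Sets"
    "Jordan_Normal_Form.Matrix"
begin

text \<open>
  The space \<open>F\<^sub>2\<^sup>n\<close> is \<^term>\<open>carrier_vec n :: bit vec set\<close>, the vectors of length \<open>n\<close> over the
  two-element field \<^typ>\<open>bit\<close>; unlike a type-indexed dimension, this allows the
  quantifier over \<open>n\<close> inside the statement.
\<close>

end

theory Submission
  imports Defs "HOL-Library.Function_Algebras" "HOL-Real_Asymp.Real_Asymp"
begin

text \<open>
  Let \<open>u\<close> be the frequent vector, let \<open>I\<close> be the set of indices with \<open>d i \<noteq> u\<close>, and put
  \<open>c i = d i + u\<close> for \<open>i\<close> in \<open>I\<close>. These shifts are neither \<open>0\<close> nor \<open>u\<close>, they have sum zero, and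
  there are at most \<open>(1/4 - \<epsilon>/2) * N\<close> of them, where \<open>N = 2 ^ n\<close>. It suffices to find points \<open>a i\<close>
  in different cosets of \<open>{0, u}\<close> such that adding \<open>c i\<close> to \<open>a i\<close> permutes the points
  (\<open>pairing_of_packing\<close>): then \<open>b i = a i + c i + u\<close> completes exactly the cosets used, and all other
  cosets are pairs with difference \<open>u\<close>. Natural solutions are disjoint closed walks with steps \<open>c i\<close>,
  and every minimal zero-sum set of shifts can be ordered so as to form such a walk
  (\<open>minimal_zero_sum_packing\<close>).

  The walks have to be fitted into \<open>V\<close>, of which they occupy, with their translates by \<open>u\<close>, up to
  almost one half. If two shifts are equal, they form a walk with two vertices, and such a walk can be
  placed by translation as long as less than half of \<open>V\<close> is occupied (\<open>greedy_extension\<close>). So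
  equal shifts are paired off and left to the end, and the other shifts may be assumed distinct.

  For longer walks the greedy bound is too weak, but while a positive proportion of distinct shifts is
  left, the Cayley graph on the free points is dense, and a count of paths of length two produces
  four-cycles with distinct steps (\<open>dense_four_cycle\<close>). This works until only \<open>\<delta> * N\<close> shifts are left,
  for a small constant \<open>\<delta>\<close>. From these one takes zero-sum quadruples until none is left. The final rest
  has only order \<open>sqrt N\<close> elements and splits into minimal zero-sum sets of at most \<open>n + 1\<close> elements.

  It remains to place the quadruples and the rest. For the quadruples, the dense stage keeps free
  a sparse set, the \<open>reserve\<close>, that contains a positive proportion of the translates of every
  four-element set. The rest is so small that it could be placed greedily in an empty space, so it is
  placed without regard to the four-cycles; those it hits are few, are removed, and go into the
  reserve as well (\<open>packing_exists_inj\<close>).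
\<close>

section \<open>Maximal disjoint families\<close>

lemma maximal_disjoint_subfamily:
  assumes "finite I"
  shows "\<exists>\<P>. disjoint \<P> \<and> (\<forall>g\<in>\<P>. g \<subseteq> I \<and> g \<noteq> {} \<and> P g) \<and>
              (\<forall>g. g \<subseteq> I - \<Union>\<P> \<longrightarrow> g \<noteq> {} \<longrightarrow> \<not> P g)"
  using assms
proof (induction I rule: finite_psubset_induct)
  case (psubset I)
  show ?case
  proof (cases "\<exists>g\<subseteq>I. g \<noteq> {} \<and> P g")
    case False
    then have "disjoint {} \<and> (\<forall>g\<in>{}. g \<subseteq> I \<and> g \<noteq> {} \<and> P g) \<and>
        (\<forall>g. g \<subseteq> I - \<Union>{} \<longrightarrow> g \<noteq> {} \<longrightarrow> \<not> P g)"
      by (auto simp: disjoint_def)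
    then show ?thesis by blast
  next
    case True
    then obtain g where g: "g \<subseteq> I" "g \<noteq> {}" "P g" by blast
    then have "I - g \<subset> I" by blast
    from psubset.IH[OF this] obtain \<P> where \<P>: "disjoint \<P>"
      "\<forall>h\<in>\<P>. h \<subseteq> I - g \<and> h \<noteq> {} \<and> P h"
      "\<forall>h. h \<subseteq> I - g - \<Union>\<P> \<longrightarrow> h \<noteq> {} \<longrightarrow> \<not> P h" by blast
    have "disjoint (insert g \<P>)"
      using \<P>(1,2) unfolding disjoint_def by blast
    moreover have "I - \<Union>(insert g \<P>) = I - g - \<Union>\<P>" by blast
    ultimately have "disjoint (insert g \<P>) \<and>
        (\<forall>h\<in>insert g \<P>. h \<subseteq> I \<and> h \<noteq> {} \<and> P h) \<and>
        (\<forall>h. h \<subseteq> I - \<Union>(insert g \<P>) \<longrightarrow> h \<noteq> {} \<longrightarrow> \<not> P h)"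
      using \<P> g by auto
    then show ?thesis by blast
  qed
qed

text \<open>
  Splitting off zero-sum groups keeps the total sum, so the zero-sum condition survives every
  stage in which some indices are set aside.
\<close>

lemma sum_diff_zero_subfamily:
  fixes c :: "'i \<Rightarrow> 'a::ab_group_add"
  assumes "finite I" "disjoint \<P>" "\<forall>g\<in>\<P>. g \<subseteq> I \<and> sum c g = 0"
  shows "sum c (I - \<Union>\<P>) = sum c I"
proof -
  have "\<forall>g\<in>\<P>. finite g" using assms finite_subset by blast
  then have "sum c (\<Union>\<P>) = sum (sum c) \<P>"
    using assms(2) sum.Union_disjoint[of \<P> c] by (simp add: disjoint_def)
  also have "\<dots> = 0" using assms by simp
  finally show ?thesis
    using assms by (subst sum_diff) auto
qed

section \<open>Packings of groups of shifts\<close>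

text \<open>
  An elementary abelian 2-group \<open>V\<close> with a distinguished nonzero element \<open>u\<close>, which is
  the frequent difference in the application. Working in \<open>V\<close> with sets that do not meet their own
  translate by \<open>u\<close> replaces working in the quotient by \<open>{0, u}\<close>, and keeps all sums exact
  instead of exact up to \<open>u\<close>.
\<close>

locale two_group =
  fixes V :: "'a::ab_group_add set" and u :: 'a
  assumes finite_V: "finite V" and zero_V: "0 \<in> V"
    and add_V: "\<And>x y. x \<in> V \<Longrightarrow> y \<in> V \<Longrightarrow> x + y \<in> V"
    and double: "\<And>x::'a. x + x = 0"
    and u_V: "u \<in> V" and u_nonzero: "u \<noteq> 0"
begin

lemma double_left: "x + (x + y) = (y::'a)"
  using double[of x] by (simp add: add.assoc[symmetric])

lemmas cancel = double double_left add.assoc add.commute add.left_commute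

lemma add_eq_iff: "x + y = z \<longleftrightarrow> x = y + (z::'a)"
proof -
  have "x + y = z" if "x = y + z" using that double_left[of y z] by (simp add: add.commute)
  moreover have "x = y + z" if "x + y = z"
    using that[symmetric] double_left[of y x] by (simp add: add.commute)
  ultimately show ?thesis by blast
qed

text \<open>
  Separation means that the points \<open>a i\<close> lie in different cosets of \<open>{0, u}\<close>.
\<close>

definition separated :: "('i \<Rightarrow> 'a) \<Rightarrow> 'i set \<Rightarrow> bool" where
  "separated a G \<longleftrightarrow> (\<forall>i\<in>G. \<forall>j\<in>G. i \<noteq> j \<longrightarrow> a i + a j \<noteq> 0 \<and> a i + a j \<noteq> u)"

text \<open>
  A family of disjoint index groups, each of which is mapped to points of \<open>V\<close> in such a way that
  shifting every \<open>a i\<close> by \<open>c i\<close> permutes the points of the group. A typical group is a closed walk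
  in the Cayley graph with steps \<open>c i\<close>. The permutation is required group by group, not only for
  the union, because single groups are later taken out and put elsewhere.
\<close>

definition packing :: "('i \<Rightarrow> 'a) \<Rightarrow> ('i \<Rightarrow> 'a) \<Rightarrow> 'i set set \<Rightarrow> bool" where
  "packing c a \<G> \<longleftrightarrow> disjoint \<G> \<and> separated a (\<Union>\<G>) \<and>
     (\<forall>g\<in>\<G>. a ` g \<subseteq> V \<and> (\<lambda>i. a i + c i) ` g = a ` g)"

text \<open>
  The cosets of \<open>{0, u}\<close> met by the placed points; a further point extends a separated
  placement exactly if it avoids this set.
\<close>

definition occupied :: "('i \<Rightarrow> 'a) \<Rightarrow> 'i set \<Rightarrow> 'a set" where
  "occupied a G = a ` G \<union> (\<lambda>i. a i + u) ` G"

lemma card_occupied_le: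
  assumes "finite G"
  shows "card (occupied a G) \<le> 2 * card G"
proof -
  have "card (occupied a G) \<le> card (a ` G) + card ((\<lambda>i. a i + u) ` G)"
    unfolding occupied_def by (rule card_Un_le)
  also have "\<dots> \<le> card G + card G"
    using assms by (intro add_mono card_image_le)
  finally show ?thesis by simp
qed

lemma finite_occupied: "finite G \<Longrightarrow> finite (occupied a G)"
  by (simp add: occupied_def)

lemma occupied_Un: "occupied a (G \<union> H) = occupied a G \<union> occupied a H"
  by (auto simp: occupied_def)

lemma occupied_cong: "(\<And>i. i \<in> G \<Longrightarrow> a i = b i) \<Longrightarrow> occupied a G = occupied b G"
  unfolding occupied_def by (intro arg_cong2[where f = union] image_cong) auto

lemma separated_inj_on: "separated a G \<Longrightarrow> inj_on a G"
  unfolding separated_def by (intro inj_onI) (metis double)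

text \<open>
  A sum over a group does not change under a permutation of the points, so the shifts cancel.
\<close>

lemma packing_sum_eq_0:
  assumes "packing c a \<G>" "g \<in> \<G>"
  shows "sum c g = 0"
proof -
  show ?thesis
  proof (cases "finite g")
    case True
    have inj: "inj_on a g"
      using assms separated_inj_on unfolding packing_def by (meson Union_upper inj_on_subset)
    have im: "(\<lambda>i. a i + c i) ` g = a ` g"
      using assms by (auto simp: packing_def)
    then have "inj_on (\<lambda>i. a i + c i) g"
      using True inj by (metis card_image eq_card_imp_inj_on)
    then have "sum (\<lambda>i. a i + c i) g = sum (\<lambda>x. x) ((\<lambda>i. a i + c i) ` g)"
      by (simp add: sum.reindex)
    also have "\<dots> = sum a g"
      unfolding im using inj by (simp add: sum.reindex)
    finally show ?thesis by (simp add: sum.distrib)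
  qed simp
qed

lemma separated_subset: "separated a G \<Longrightarrow> H \<subseteq> G \<Longrightarrow> separated a H"
  unfolding separated_def by (meson subsetD)

lemma packing_subfamily: "packing c a \<G> \<Longrightarrow> \<H> \<subseteq> \<G> \<Longrightarrow> packing c a \<H>"
  unfolding packing_def by (meson Union_mono pairwise_subset separated_subset subsetD)

lemma packing_union:
  assumes "packing c a \<G>" "packing c b \<H>" "\<Union>\<G> \<inter> \<Union>\<H> = {}"
    and apart: "\<And>i j. i \<in> \<Union>\<G> \<Longrightarrow> j \<in> \<Union>\<H> \<Longrightarrow> b j \<notin> occupied a {i}"
  shows "packing c (\<lambda>i. if i \<in> \<Union>\<H> then b i else a i) (\<G> \<union> \<H>)"
proof -
  define f where "f = (\<lambda>i. if i \<in> \<Union>\<H> then b i else a i)"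
  have fa: "f i = a i" if "i \<in> \<Union>\<G>" for i using assms(3) that by (auto simp: f_def)
  have fb: "f i = b i" if "i \<in> \<Union>\<H>" for i using that by (auto simp: f_def)
  have cross: "f i + f j \<noteq> 0 \<and> f i + f j \<noteq> u" if "i \<in> \<Union>\<G>" "j \<in> \<Union>\<H>" for i j
  proof -
    have "b j \<noteq> a i" "b j \<noteq> a i + u"
      using apart[OF that] by (auto simp: occupied_def)
    then show ?thesis
      unfolding fa[OF that(1)] fb[OF that(2)] by (metis add_0_right double_left)
  qed
  have aa: "f i + f j \<noteq> 0 \<and> f i + f j \<noteq> u" if "i \<in> \<Union>\<G>" "j \<in> \<Union>\<G>" "i \<noteq> j" for i j
    using assms(1) that unfolding fa[OF that(1)] fa[OF that(2)] packing_def separated_def by blast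
  have bb: "f i + f j \<noteq> 0 \<and> f i + f j \<noteq> u" if "i \<in> \<Union>\<H>" "j \<in> \<Union>\<H>" "i \<noteq> j" for i j
    using assms(2) that unfolding fb[OF that(1)] fb[OF that(2)] packing_def separated_def by blast
  have "packing c f (\<G> \<union> \<H>)"
    unfolding packing_def
  proof (intro conjI ballI)
    show "disjoint (\<G> \<union> \<H>)"
      using assms(1-3) by (intro disjoint_union) (auto simp: packing_def)
    show "separated f (\<Union>(\<G> \<union> \<H>))"
      unfolding separated_def Union_Un_distrib
    proof (intro ballI impI)
      fix i j assume ij: "i \<in> \<Union>\<G> \<union> \<Union>\<H>" "j \<in> \<Union>\<G> \<union> \<Union>\<H>" "i \<noteq> j"
      then consider "i \<in> \<Union>\<G>" "j \<in> \<Union>\<G>" | "i \<in> \<Union>\<H>" "j \<in> \<Union>\<H>" | "i \<in> \<Union>\<G>" "j \<in> \<Union>\<H>"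
        | "j \<in> \<Union>\<G>" "i \<in> \<Union>\<H>" by blast
      then show "f i + f j \<noteq> 0 \<and> f i + f j \<noteq> u"
      proof cases
        case 4
        show ?thesis using cross[OF 4] unfolding add.commute[of "f j" "f i"] .
      qed (use aa bb cross ij in simp_all)
    qed
    fix g assume "g \<in> \<G> \<union> \<H>"
    then consider "g \<in> \<G>" | "g \<in> \<H>" by blast
    then show "f ` g \<subseteq> V" "(\<lambda>i. f i + c i) ` g = f ` g"
    proof (atomize (full), cases)
      case 1
      then have "f i = a i" if "i \<in> g" for i using fa that by blast
      then have "f ` g = a ` g" "(\<lambda>i. f i + c i) ` g = (\<lambda>i. a i + c i) ` g"
        by (intro image_cong; simp)+
      then show "f ` g \<subseteq> V \<and> (\<lambda>i. f i + c i) ` g = f ` g"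
        using assms(1) 1 unfolding packing_def by metis
    next
      case 2
      then have "f i = b i" if "i \<in> g" for i using fb that by blast
      then have "f ` g = b ` g" "(\<lambda>i. f i + c i) ` g = (\<lambda>i. b i + c i) ` g"
        by (intro image_cong; simp)+
      then show "f ` g \<subseteq> V \<and> (\<lambda>i. f i + c i) ` g = f ` g"
        using assms(2) 2 unfolding packing_def by metis
    qed
  qed
  then show ?thesis by (simp only: f_def)
qed

lemma packing_translate:
  assumes "packing c p \<G>" "x \<in> V"
  shows "packing c (\<lambda>i. x + p i) \<G>"
proof -
  have eq: "(x + p i) + (x + p j) = p i + p j" for i j by (simp add: cancel)
  have "(\<lambda>i. x + p i + c i) ` g = (\<lambda>i. x + p i) ` g" if "g \<in> \<G>" for g
  proof -
    have "(\<lambda>i. x + p i + c i) ` g = (+) x ` ((\<lambda>i. p i + c i) ` g)"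
      by (simp add: image_image add.assoc)
    also have "\<dots> = (\<lambda>i. x + p i) ` g"
      using assms that by (simp add: packing_def image_image)
    finally show ?thesis .
  qed
  moreover have "separated (\<lambda>i. x + p i) (\<Union>\<G>)"
    using assms(1) unfolding packing_def separated_def eq by blast
  moreover have "(\<lambda>i. x + p i) ` g \<subseteq> V" if "g \<in> \<G>" for g
    using assms that add_V unfolding packing_def by blast
  ultimately show ?thesis
    using assms(1) unfolding packing_def by simp
qed

text \<open>
  Greedy placement by translation. A group with at most \<open>L\<close> indices and a shape \<open>p\<close> has at least
  \<open>K\<close> translates inside \<open>R\<close>, and each occupied point of \<open>R\<close> spoils at most \<open>L\<close> of them. Only the
  part of the old packing that meets \<open>R\<close> counts, which is what makes a reserved region useful.
\<close>

lemma greedy_extension: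
  fixes R :: "'a set"
  assumes "finite \<H>" "packing c a \<G>" "finite (\<Union>\<G>)" "disjoint \<H>" "\<Union>\<G> \<inter> \<Union>\<H> = {}"
    and "\<forall>g\<in>\<H>. finite g \<and> card g \<le> L \<and>
           (\<exists>p. packing c p {g} \<and> K \<le> card {x\<in>V. \<forall>i\<in>g. x + p i \<in> R})"
    and "L * (card (occupied a (\<Union>\<G>) \<inter> R) + 2 * card (\<Union>\<H>)) < K"
  shows "\<exists>a'. packing c a' (\<G> \<union> \<H>) \<and> (\<forall>i\<in>\<Union>\<G>. a' i = a i)"
  using assms
proof (induction \<H> rule: finite_induct)
  case empty
  then show ?case by auto
next
  case (insert g \<H>)
  have finH: "finite (\<Union>\<H>)" using insert by auto
  have fing: "finite g" "card g \<le> L" using insert.prems by auto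
  have disj: "g \<inter> \<Union>\<H> = {}"
    using insert.prems(3) insert.hyps disjointD[of "insert g \<H>" g] by blast
  have "card (\<Union>(insert g \<H>)) = card g + card (\<Union>\<H>)"
    using disj fing finH by (simp add: card_Un_disjoint)
  then have less: "L * (card (occupied a (\<Union>\<G>) \<inter> R) + 2 * card (\<Union>\<H>)) < K"
    using insert.prems(6) by (elim order_le_less_trans[rotated], intro mult_le_mono) auto
  have "disjoint \<H>" "\<Union>\<G> \<inter> \<Union>\<H> = {}"
    using insert.prems(3,4) by (auto simp: pairwise_insert)
  then obtain a' where a': "packing c a' (\<G> \<union> \<H>)" "\<forall>i\<in>\<Union>\<G>. a' i = a i"
    using insert.IH[OF insert.prems(1,2) _ _ _ less] insert.prems(5) by blast
  obtain p where p: "packing c p {g}" "K \<le> card {x\<in>V. \<forall>i\<in>g. x + p i \<in> R}"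
    using insert.prems(5) by auto
  define W where "W = occupied a' (\<Union>(\<G> \<union> \<H>)) \<inter> R"
  have finW: "finite W"
    unfolding W_def using insert.prems(2) finH by (simp add: finite_occupied)
  have "W \<subseteq> (occupied a (\<Union>\<G>) \<inter> R) \<union> occupied a' (\<Union>\<H>)"
    unfolding W_def Union_Un_distrib occupied_Un
    using occupied_cong[of "\<Union>\<G>" a' a] a'(2) by auto
  then have "card W \<le> card ((occupied a (\<Union>\<G>) \<inter> R) \<union> occupied a' (\<Union>\<H>))"
    using insert.prems(2) finH by (intro card_mono) (auto simp: finite_occupied)
  also have "\<dots> \<le> card (occupied a (\<Union>\<G>) \<inter> R) + 2 * card (\<Union>\<H>)"
    using card_Un_le card_occupied_le[OF finH] by (meson add_left_mono order_trans)
  finally have cardW: "card W \<le> card (occupied a (\<Union>\<G>) \<inter> R) + 2 * card (\<Union>\<H>)" .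
  \<comment> \<open>the translations that move some point of the shape onto an occupied point\<close>
  define B where "B = (\<Union>i\<in>g. (\<lambda>w. w + p i) ` W)"
  have "card B \<le> (\<Sum>i\<in>g. card ((\<lambda>w. w + p i) ` W))"
    unfolding B_def by (rule card_UN_le[OF fing(1)])
  also have "\<dots> \<le> card g * card W"
    using card_image_le[OF finW] by (metis (mono_tags, lifting) of_nat_id sum_bounded_above)
  also have "\<dots> < K"
    using less cardW fing(2) by (meson mult_le_mono order_le_less_trans)
  finally have "card B < card {x\<in>V. \<forall>i\<in>g. x + p i \<in> R}" using p(2) by simp
  moreover have "finite B" unfolding B_def using fing finW by auto
  ultimately have "\<not> {x\<in>V. \<forall>i\<in>g. x + p i \<in> R} \<subseteq> B"
    by (meson card_mono leD)
  then obtain x where x: "x \<in> V" "\<forall>i\<in>g. x + p i \<in> R" "x \<notin> B" by auto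
  have avoid: "x + p i \<notin> occupied a' (\<Union>(\<G> \<union> \<H>))" if "i \<in> g" for i
  proof
    assume "x + p i \<in> occupied a' (\<Union>(\<G> \<union> \<H>))"
    then have "x + p i \<in> W" using x(2) that by (simp add: W_def)
    then have "(x + p i) + p i \<in> B" using that unfolding B_def by blast
    then show False using x(3) by (simp add: cancel)
  qed
  have "packing c (\<lambda>i. if i \<in> \<Union>{g} then x + p i else a' i) ((\<G> \<union> \<H>) \<union> {g})"
  proof (rule packing_union[OF a'(1) packing_translate[OF p(1) x(1)]])
    show "\<Union> (\<G> \<union> \<H>) \<inter> \<Union> {g} = {}" using disj insert.prems(4) by auto
    show "x + p j \<notin> occupied a' {i}" if "i \<in> \<Union> (\<G> \<union> \<H>)" "j \<in> \<Union> {g}" for i j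
      using avoid[of j] that unfolding occupied_def by blast
  qed
  moreover have "(\<G> \<union> \<H>) \<union> {g} = \<G> \<union> insert g \<H>" by auto
  moreover have "\<forall>i\<in>\<Union>\<G>. (if i \<in> \<Union>{g} then x + p i else a' i) = a i"
    using a'(2) insert.prems(4) by auto
  ultimately show ?case by (intro exI[of _ "\<lambda>i. if i \<in> \<Union>{g} then x + p i else a' i"] conjI) simp_all
qed


section \<open>Minimal zero-sum sets can be arranged in a cycle\<close>

lemma sum_symmetric_difference:
  fixes c :: "'i \<Rightarrow> 'a"
  assumes "finite A" "finite B"
  shows "sum c ((A - B) \<union> (B - A)) = sum c A + sum c B"
proof -
  have "sum c A = sum c (A \<inter> B) + sum c (A - B)" "sum c B = sum c (A \<inter> B) + sum c (B - A)"
    using assms sum.Int_Diff by (metis, metis inf_commute)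
  moreover have "sum c ((A - B) \<union> (B - A)) = sum c (A - B) + sum c (B - A)"
    using assms by (intro sum.union_disjoint) auto
  ultimately show ?thesis by (simp add: cancel)
qed

definition minimal_zero_sum :: "('i \<Rightarrow> 'a) \<Rightarrow> 'i set \<Rightarrow> bool" where
  "minimal_zero_sum c g \<longleftrightarrow>
     finite g \<and> g \<noteq> {} \<and> sum c g = 0 \<and> (\<forall>B. B \<subset> g \<longrightarrow> B \<noteq> {} \<longrightarrow> sum c B \<noteq> 0)"

lemma minimal_zero_sum_exists:
  assumes "finite I" "I \<noteq> {}" "sum c I = 0"
  shows "\<exists>g\<subseteq>I. minimal_zero_sum c g"
  using assms
proof (induction I rule: finite_psubset_induct)
  case (psubset I)
  show ?case
  proof (cases "minimal_zero_sum c I")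
    case False
    then obtain B where B: "B \<subset> I" "B \<noteq> {}" "sum c B = 0"
      using psubset by (auto simp: minimal_zero_sum_def)
    then show ?thesis using psubset.IH[OF B] by blast
  qed auto
qed

text \<open>
  Two subsets with the same sum have a symmetric difference of sum zero, which minimality forces to
  be empty or everything.
\<close>

lemma minimal_zero_sum_symmetric_difference:
  assumes "minimal_zero_sum c g" "A \<subseteq> g" "B \<subseteq> g" "sum c A = sum c B"
  shows "B = A \<or> B = g - A"
proof -
  have fin: "finite A" "finite B"
    using assms finite_subset by (auto simp: minimal_zero_sum_def)
  let ?D = "(A - B) \<union> (B - A)"
  have "sum c ?D = 0"
    using sum_symmetric_difference[OF fin, of c] assms(4) by (simp add: double)
  moreover have "?D \<subseteq> g" using assms(2,3) by blast
  ultimately have "?D = {} \<or> ?D = g"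
    using assms(1) unfolding minimal_zero_sum_def by (meson psubsetI)
  then show ?thesis
  proof
    assume "?D = {}"
    then show ?thesis by auto
  next
    assume "?D = g"
    then have "B = g - A" using assms(2,3) by (intro equalityI subsetI) auto
    then show ?thesis ..
  qed
qed

text \<open>
  The subsets that avoid one fixed element have pairwise different sums, so there are at most as many
  as elements of \<open>V\<close>.
\<close>

lemma minimal_zero_sum_card:
  assumes "minimal_zero_sum c g" "c ` g \<subseteq> V"
  shows "2 ^ (card g - 1) \<le> card V"
proof -
  have fin: "finite g" using assms by (simp add: minimal_zero_sum_def)
  obtain e where e: "e \<in> g" using assms by (auto simp: minimal_zero_sum_def)
  have inj: "inj_on (sum c) (Pow (g - {e}))"
  proof (rule inj_onI)
    fix A B assume "A \<in> Pow (g - {e})" "B \<in> Pow (g - {e})" "sum c A = sum c B"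
    then have "B = A \<or> B = g - A" "e \<notin> A" "e \<notin> B"
      using minimal_zero_sum_symmetric_difference[OF assms(1), of A B] by auto
    then show "A = B" using e by blast
  qed
  have sum_V: "sum c B \<in> V" if "B \<subseteq> g" for B
  proof -
    have "finite B" using fin that finite_subset by blast
    then show ?thesis using that
      by (induction B) (use zero_V add_V assms(2) in auto)
  qed
  have "2 ^ (card g - 1) = card (Pow (g - {e}))"
    using fin e by (simp add: card_Pow)
  also have "\<dots> = card (sum c ` Pow (g - {e}))" using card_image[OF inj] by simp
  also have "\<dots> \<le> card V"
    using sum_V by (intro card_mono[OF finite_V]) blast
  finally show ?thesis .
qed

text \<open>
  At most one complementary pair of subsets \<open>A\<close> and \<open>g - A\<close> has sum \<open>u\<close>. Both have at least two
  elements, as no single \<open>c i\<close> equals \<open>u\<close>, so an ordering that starts with elements taken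
  alternately from \<open>A\<close>, \<open>g - A\<close>, \<open>A\<close>, \<open>g - A\<close> keeps either of them from being an interval.
\<close>

lemma minimal_zero_sum_ordering:
  assumes "minimal_zero_sum c g" "\<forall>i\<in>g. c i \<noteq> u"
  shows "\<exists>xs. distinct xs \<and> set xs = g \<and>
           (\<forall>k l. k < l \<longrightarrow> l < length xs \<longrightarrow> sum c ((!) xs ` {k..<l}) \<noteq> u)"
proof (cases "\<exists>A\<subseteq>g. sum c A = u")
  case False
  have "finite g" using assms(1) by (simp add: minimal_zero_sum_def)
  then obtain xs where xs: "set xs = g" "distinct xs" using finite_distinct_list by blast
  have "(!) xs ` {k..<l} \<subseteq> g" if "l < length xs" for k l
    using that xs(1) by auto
  then show ?thesis using False xs by blast
next
  case True
  then obtain A where A: "A \<subseteq> g" "sum c A = u" by blast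
  have fin: "finite g" using assms by (simp add: minimal_zero_sum_def)
  have two: "\<exists>x y. x \<in> B \<and> y \<in> B \<and> x \<noteq> y" if "B \<subseteq> g" "sum c B = u" for B
  proof -
    have "B \<noteq> {}" using that(2) u_nonzero by auto
    then obtain x where x: "x \<in> B" by blast
    have "B \<noteq> {x}" using that x assms(2) by auto
    then show ?thesis using x by blast
  qed
  have "sum c (g - A) + sum c A = 0"
    using sum.subset_diff[OF A(1) fin, of c] assms(1) by (simp add: minimal_zero_sum_def)
  then have "sum c (g - A) = u" using A(2) add_eq_iff by auto
  then obtain b\<^sub>1 b\<^sub>2 where b: "b\<^sub>1 \<in> g - A" "b\<^sub>2 \<in> g - A" "b\<^sub>1 \<noteq> b\<^sub>2"
    using two[of "g - A"] by blast
  obtain a\<^sub>1 a\<^sub>2 where a: "a\<^sub>1 \<in> A" "a\<^sub>2 \<in> A" "a\<^sub>1 \<noteq> a\<^sub>2"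
    using two[OF A] by blast
  obtain ys where ys: "set ys = g - {a\<^sub>1, b\<^sub>1, a\<^sub>2, b\<^sub>2}" "distinct ys"
    using fin finite_distinct_list by (metis finite_Diff)
  define xs where "xs = a\<^sub>1 # b\<^sub>1 # a\<^sub>2 # b\<^sub>2 # ys"
  have xs: "distinct xs" "set xs = g"
    using ys a b A by (auto simp: xs_def)
  have nths: "xs ! 0 = a\<^sub>1" "xs ! 1 = b\<^sub>1" "xs ! 2 = a\<^sub>2" "xs ! 3 = b\<^sub>2" "3 < length xs"
    by (simp_all add: xs_def eval_nat_numeral)
  have "sum c ((!) xs ` {k..<l}) \<noteq> u" if kl: "k < l" "l < length xs" for k l
  proof
    define B where "B = (!) xs ` {k..<l}"
    assume "sum c ((!) xs ` {k..<l}) = u"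
    then have "sum c A = sum c B" using A(2) by (simp add: B_def)
    moreover have "B \<subseteq> g" using xs(2) kl by (auto simp: B_def)
    ultimately have BA: "B = A \<or> B = g - A"
      using minimal_zero_sum_symmetric_difference[OF assms(1) A(1)] by blast
    have mem: "xs ! j \<in> B \<longleftrightarrow> k \<le> j \<and> j < l" if "j \<le> 3" for j
      using that kl nths(5) nth_eq_iff_index_eq[OF xs(1)] by (auto simp: B_def image_iff)
    show False
      using BA
    proof
      assume "B = A"
      then have "xs ! 0 \<in> B" "xs ! 2 \<in> B" "xs ! 1 \<notin> B" using a b unfolding nths by auto
      then show False using mem[of 0] mem[of 1] mem[of 2] by simp
    next
      assume "B = g - A"
      then have "xs ! 1 \<in> B" "xs ! 3 \<in> B" "xs ! 2 \<notin> B" using a b unfolding nths by auto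
      then show False using mem[of 1] mem[of 2] mem[of 3] by simp
    qed
  qed
  then show ?thesis using xs by blast
qed

text \<open>
  The partial sums \<open>P k\<close> along a good ordering are the vertices of a closed walk with steps \<open>c i\<close>.
  Two of them differ by the sum over an interval, which is nonzero by minimality and not \<open>u\<close> by the
  choice of the ordering.
\<close>

lemma minimal_zero_sum_packing:
  assumes "minimal_zero_sum c g" "c ` g \<subseteq> V" "\<forall>i\<in>g. c i \<noteq> u"
  shows "\<exists>p. packing c p {g}"
proof -
  obtain xs where xs: "distinct xs" "set xs = g"
    "\<And>k l. k < l \<Longrightarrow> l < length xs \<Longrightarrow> sum c ((!) xs ` {k..<l}) \<noteq> u"
    using minimal_zero_sum_ordering[OF assms(1,3)] by blast
  define r where "r = length xs"
  define P where "P k = (\<Sum>j<k. c (xs ! j))" for k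
  define p where "p i = P (the_inv_into {..<r} ((!) xs) i)" for i
  have inj: "inj_on ((!) xs) {..<r}"
    using xs(1) by (simp add: inj_on_nth r_def)
  have p_nth: "p (xs ! k) = P k" if "k < r" for k
    using that inj by (simp add: p_def the_inv_into_f_f)
  have g_eq: "g = (!) xs ` {..<r}"
    using xs(2) by (auto simp: r_def set_conv_nth)
  have "P r = sum c g"
    unfolding P_def g_eq sum.reindex[OF inj] by simp
  then have P_r: "P r = 0" using assms(1) by (simp add: minimal_zero_sum_def)
  have P_0: "P 0 = 0" by (simp add: P_def)
  have r_pos: "r > 0" using assms(1) g_eq by (auto simp: minimal_zero_sum_def)
  have P_V: "P k \<in> V" if "k \<le> r" for k
    using that
  proof (induction k)
    case (Suc k)
    then have "c (xs ! k) \<in> V" using assms(2) by (auto simp: g_eq)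
    then show ?case using Suc add_V by (simp add: P_def)
  qed (simp add: P_0 zero_V)
  have P_add: "P k + P l \<noteq> 0 \<and> P k + P l \<noteq> u" if "k < l" "l < r" for k l
  proof -
    have "P l = P k + (\<Sum>j=k..<l. c (xs ! j))"
      unfolding P_def using that by (metis atLeast0LessThan less_imp_le sum.atLeastLessThan_concat zero_le)
    then have "P k + P l = (\<Sum>j=k..<l. c (xs ! j))" by (simp add: double_left)
    also have "\<dots> = sum c ((!) xs ` {k..<l})"
    proof -
      have "{k..<l} \<subseteq> {..<r}" using that by auto
      then show ?thesis using inj_on_subset[OF inj] by (subst sum.reindex) auto
    qed
    finally have eq: "P k + P l = sum c ((!) xs ` {k..<l})" .
    have "(!) xs ` {k..<l} \<subseteq> g" using that by (auto simp: g_eq)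
    moreover have "xs ! l \<notin> (!) xs ` {k..<l}"
    proof
      assume "xs ! l \<in> (!) xs ` {k..<l}"
      then obtain j where "j < l" "xs ! j = xs ! l" by auto
      then show False using inj_onD[OF inj, of j l] that by simp
    qed
    moreover have "xs ! l \<in> g" using that by (simp add: g_eq)
    ultimately have "(!) xs ` {k..<l} \<subset> g" by blast
    moreover have "(!) xs ` {k..<l} \<noteq> {}" using that by auto
    ultimately have "sum c ((!) xs ` {k..<l}) \<noteq> 0"
      using assms(1) by (auto simp: minimal_zero_sum_def)
    then show ?thesis using xs(3) that eq by (simp add: r_def)
  qed
  have "separated p g"
    unfolding separated_def
  proof (intro ballI impI)
    fix i j assume "i \<in> g" "j \<in> g" "i \<noteq> j"
    then obtain k l where "i = xs ! k" "j = xs ! l" "k < r" "l < r" "k \<noteq> l"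
      by (auto simp: g_eq)
    then show "p i + p j \<noteq> 0 \<and> p i + p j \<noteq> u"
      using P_add[of k l] P_add[of l k] p_nth by (cases "k < l") (auto simp: add.commute)
  qed
  moreover have "p ` g = P ` {..<r}"
    using p_nth by (auto simp: g_eq image_image)
  moreover have "(\<lambda>i. p i + c i) ` g = P ` {..<r}"
  proof -
    have "(\<lambda>i. p i + c i) ` g = (\<lambda>k. P (Suc k)) ` {..<r}"
      using p_nth unfolding g_eq image_image by (intro image_cong) (auto simp: P_def)
    also have "\<dots> = P ` Suc ` {..<r}" by (simp add: image_image)
    also have "\<dots> = P ` {1..r}" by (simp add: lessThan_atLeast0 image_Suc_atLeastLessThan atLeastLessThanSuc_atLeastAtMost)
    also have "{1..r} = insert r {1..<r}" using r_pos by auto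
    also have "P ` insert r {1..<r} = P ` insert 0 {1..<r}" using P_r P_0 by simp
    also have "insert 0 {1..<r} = {..<r}" using r_pos by auto
    finally show ?thesis .
  qed
  ultimately have "packing c p {g}"
    using P_V by (auto simp: packing_def disjoint_def)
  then show ?thesis by blast
qed

section \<open>Four-cycles in dense Cayley graphs\<close>

lemma card_translation_overlap:
  assumes "F \<subseteq> V" "s \<in> V"
  shows "2 * card F \<le> card V + card {y\<in>F. y + s \<in> F}"
proof -
  have fin: "finite F" using assms finite_V finite_subset by blast
  have "card ((\<lambda>y. y + s) ` F) = card F"
    by (rule card_image) (auto simp: inj_on_def)
  then have "2 * card F = card F + card ((\<lambda>y. y + s) ` F)" by simp
  also have "\<dots> = card (F \<union> (\<lambda>y. y + s) ` F) + card (F \<inter> (\<lambda>y. y + s) ` F)"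
    using fin by (intro card_Un_Int) auto
  also have "\<dots> \<le> card V + card {y\<in>F. y + s \<in> F}"
  proof (rule add_mono)
    show "card (F \<union> (\<lambda>y. y + s) ` F) \<le> card V"
      using assms add_V by (intro card_mono[OF finite_V]) auto
    show "card (F \<inter> (\<lambda>y. y + s) ` F) \<le> card {y\<in>F. y + s \<in> F}"
      using fin by (intro card_mono) (auto simp: add.assoc double)
  qed
  finally show ?thesis .
qed

text \<open>
  The vertices of a closed walk of length four with steps in \<open>S\<close>. The conditions on the two
  diagonals put opposite vertices into different cosets of \<open>{0, u}\<close>; together with the last condition they
  make the four steps distinct (the sum of all vertices vanishes exactly if opposite steps agree).
\<close>

definition four_cycle :: "'a set \<Rightarrow> 'a \<Rightarrow> 'a \<Rightarrow> 'a \<Rightarrow> 'a \<Rightarrow> bool" where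
  "four_cycle S x y z w \<longleftrightarrow> {x + y, y + z, z + w, w + x} \<subseteq> S \<and>
     x + z \<noteq> 0 \<and> x + z \<noteq> u \<and> y + w \<noteq> 0 \<and> y + w \<noteq> u \<and> x + y + z + w \<noteq> 0"

text \<open>
  For given \<open>x\<close>, \<open>z\<close> and first common neighbour \<open>y\<close> only three choices of \<open>w\<close> are degenerate, so a
  fourth common neighbour is enough.
\<close>

lemma four_cycle_from_common_neighbours:
  assumes "finite F" "x \<in> F" "z \<in> F" "x + z \<noteq> 0" "x + z \<noteq> u"
    and "3 < card {y\<in>F. x + y \<in> S \<and> z + y \<in> S}"
  shows "\<exists>x y z w. {x, y, z, w} \<subseteq> F \<and> four_cycle S x y z w"
proof -
  let ?C = "{y\<in>F. x + y \<in> S \<and> z + y \<in> S}"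
  have "?C \<noteq> {}" using assms(6) by (metis card.empty not_less_zero)
  then obtain y where y: "y \<in> ?C" by blast
  have "card {y, y + u, x + y + z} \<le> 3"
    by (metis card_length length_Cons list.set(1) list.set(2) list.size(3) numeral_3_eq_3)
  then have "\<not> ?C \<subseteq> {y, y + u, x + y + z}"
    using assms(6) card_mono[of "{y, y + u, x + y + z}" ?C] by auto
  then obtain w where w: "w \<in> ?C" "w \<noteq> y" "w \<noteq> y + u" "w \<noteq> x + y + z" by blast
  have "y + w \<noteq> 0" "y + w \<noteq> u" "x + y + z + w \<noteq> 0"
    using w(2-4) by (auto simp: add_eq_iff double_left add.commute)
  moreover have "{x + y, y + z, z + w, w + x} \<subseteq> S"
    using y w(1) by (auto simp: add.commute[of y z] add.commute[of w x])
  ultimately have "four_cycle S x y z w"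
    using assms(4,5) by (simp add: four_cycle_def)
  moreover have "{x, y, z, w} \<subseteq> F" using assms(2,3) y w(1) by simp
  ultimately show ?thesis by blast
qed

text \<open>
  A set \<open>F\<close> with more than half of all elements overlaps every translate of itself in positive
  proportion, so each step in \<open>S\<close> gives many edges inside \<open>F\<close>, and the graph on \<open>F\<close> is dense. By
  convexity there are then of order \<open>N\<^sup>3\<close> paths of length two, with \<open>N\<close> the order of the group,
  whereas a graph without the required cycle has only \<open>5 * N\<^sup>2\<close> of them: at most three for a pair of
  end points in different cosets of \<open>{0, u}\<close>, and at most \<open>N\<close> for each of the other \<open>2 * N\<close> pairs.
\<close>

lemma dense_four_cycle:
  fixes \<eta> \<delta> :: real
  assumes F: "F \<subseteq> V" and S: "S \<subseteq> V" and nonneg: "0 \<le> \<eta>" "0 \<le> \<delta>"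
    and card_F: "(1/2 + \<eta>) * card V \<le> card F" and card_S: "\<delta> * card V \<le> card S"
    and large: "5 < 4 * \<eta>\<^sup>2 * \<delta>\<^sup>2 * card V"
  shows "\<exists>x y z w. {x, y, z, w} \<subseteq> F \<and> four_cycle S x y z w"
proof (rule ccontr)
  assume none: "\<not> ?thesis"
  define N where "N = card V"
  have fin: "finite F" "finite S" using F S finite_V finite_subset by blast+
  have FN: "card F \<le> N" unfolding N_def using F finite_V by (rule card_mono[rotated])
  have N_pos: "N > 0" unfolding N_def using zero_V finite_V card_gt_0_iff by blast
  define D where "D y = {x\<in>F. x + y \<in> S}" for y
  have "(\<Sum>y\<in>F. card (D y)) = (\<Sum>y\<in>F. card {s\<in>S. y + s \<in> F})"
  proof (rule sum.cong)
    fix y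
    have "(\<lambda>x. x + y) ` D y = {s\<in>S. y + s \<in> F}"
      by (force simp: D_def image_iff cancel)
    moreover have "inj_on (\<lambda>x. x + y) (D y)" by (auto simp: inj_on_def)
    ultimately show "card (D y) = card {s\<in>S. y + s \<in> F}" by (metis card_image)
  qed simp
  also have "\<dots> = (\<Sum>s\<in>S. card {y\<in>F. y + s \<in> F})"
    using fin by (intro sum_multicount_gen) auto
  finally have deg: "(\<Sum>y\<in>F. card (D y)) = (\<Sum>s\<in>S. card {y\<in>F. y + s \<in> F})" .
  have "2 * \<eta> * \<delta> * (real N)\<^sup>2 = (\<delta> * N) * (2 * ((1/2 + \<eta>) * N) - N)"
    by (simp add: algebra_simps power2_eq_square)
  also have "\<dots> \<le> real (card S) * (2 * real (card F) - N)"
    using card_F card_S nonneg by (intro mult_mono) (auto simp: N_def algebra_simps)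
  also have "\<dots> = (\<Sum>s\<in>S. 2 * real (card F) - N)" by simp
  also have "\<dots> \<le> (\<Sum>s\<in>S. real (card {y\<in>F. y + s \<in> F}))"
  proof (rule sum_mono)
    fix s assume "s \<in> S"
    then have "2 * card F \<le> card V + card {y\<in>F. y + s \<in> F}"
      using card_translation_overlap F S by blast
    then show "2 * real (card F) - N \<le> real (card {y\<in>F. y + s \<in> F})"
      unfolding N_def by linarith
  qed
  also have "\<dots> = (\<Sum>y\<in>F. real (card (D y)))" using arg_cong[OF deg, of real] by simp
  finally have lower: "2 * \<eta> * \<delta> * (real N)\<^sup>2 \<le> (\<Sum>y\<in>F. real (card (D y)))" .
  define C where "C q = {y\<in>F. fst q + y \<in> S \<and> snd q + y \<in> S}" for q
  have "(\<Sum>y\<in>F. (card (D y))\<^sup>2) = (\<Sum>y\<in>F. card {q\<in>F\<times>F. fst q + y \<in> S \<and> snd q + y \<in> S})"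
  proof (rule sum.cong)
    fix y
    have "{q\<in>F\<times>F. fst q + y \<in> S \<and> snd q + y \<in> S} = D y \<times> D y" by (auto simp: D_def)
    then show "(card (D y))\<^sup>2 = card {q\<in>F\<times>F. fst q + y \<in> S \<and> snd q + y \<in> S}"
      by (simp add: card_cartesian_product power2_eq_square)
  qed simp
  also have "\<dots> = (\<Sum>q\<in>F\<times>F. card (C q))"
    unfolding C_def using fin by (intro sum_multicount_gen) auto
  also have "\<dots> \<le> (\<Sum>q\<in>F\<times>F. 3 + (if fst q + snd q \<in> {0, u} then N else 0))"
  proof (rule sum_mono)
    fix q assume q: "q \<in> F \<times> F"
    show "card (C q) \<le> 3 + (if fst q + snd q \<in> {0, u} then N else 0)"
    proof (cases "fst q + snd q \<in> {0, u}")
      case True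
      have "card (C q) \<le> card F" using fin by (intro card_mono) (auto simp: C_def)
      then show ?thesis using FN True by simp
    next
      case False
      then have "\<not> 3 < card (C q)"
        using four_cycle_from_common_neighbours[OF fin(1), of "fst q" "snd q" S] q none
        unfolding C_def mem_Times_iff insert_iff by blast
      then show ?thesis by simp
    qed
  qed
  also have "\<dots> = 3 * (card F * card F) + N * card {q\<in>F\<times>F. fst q + snd q \<in> {0, u}}"
    using fin by (simp add: sum.distrib card_cartesian_product sum.If_cases Int_def)
  also have "\<dots> \<le> 3 * (N * N) + N * (2 * N)"
  proof -
    have "{q\<in>F\<times>F. fst q + snd q \<in> {0, u}} \<subseteq> (\<lambda>x. (x, x)) ` F \<union> (\<lambda>x. (x, x + u)) ` F"
    proof
      fix q assume "q \<in> {q\<in>F\<times>F. fst q + snd q \<in> {0, u}}"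
      then obtain x z where xz: "q = (x, z)" "x \<in> F" "x + z = 0 \<or> x + z = u"
        by (cases q) auto
      then have "z = x \<or> z = x + u" using double_left[of x z] by (metis add_0_right)
      with xz show "q \<in> (\<lambda>x. (x, x)) ` F \<union> (\<lambda>x. (x, x + u)) ` F" by blast
    qed
    then have "card {q\<in>F\<times>F. fst q + snd q \<in> {0, u}}
        \<le> card ((\<lambda>x. (x, x)) ` F \<union> (\<lambda>x. (x, x + u)) ` F)"
      using fin by (intro card_mono) auto
    also have "\<dots> \<le> card ((\<lambda>x. (x, x)) ` F) + card ((\<lambda>x. (x, x + u)) ` F)"
      by (rule card_Un_le)
    also have "\<dots> \<le> card F + card F"
      using fin by (intro add_mono card_image_le)
    finally have "card {q\<in>F\<times>F. fst q + snd q \<in> {0, u}} \<le> 2 * N" using FN by simp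
    then show ?thesis using FN by (intro add_mono mult_mono) auto
  qed
  finally have "(\<Sum>y\<in>F. (card (D y))\<^sup>2) \<le> 5 * N\<^sup>2" by (simp add: power2_eq_square)
  then have "real (\<Sum>y\<in>F. (card (D y))\<^sup>2) \<le> real (5 * N\<^sup>2)" by (rule of_nat_mono)
  then have upper: "(\<Sum>y\<in>F. (real (card (D y)))\<^sup>2) \<le> 5 * (real N)\<^sup>2" by simp
  \<comment> \<open>a lower bound for the average degree; the convexity of squares is used as \<open>2 * t * x - t\<^sup>2 \<le> x\<^sup>2\<close>\<close>
  define t where "t = 2 * \<eta> * \<delta> * N"
  have "t \<ge> 0" using nonneg by (simp add: t_def)
  have "t\<^sup>2 * N \<le> 2 * t * (t * N) - t\<^sup>2 * card F"
    using FN mult_left_mono[of "real (card F)" N "t\<^sup>2"] by (simp add: power2_eq_square algebra_simps)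
  also have "\<dots> \<le> 2 * t * (\<Sum>y\<in>F. real (card (D y))) - t\<^sup>2 * card F"
    using lower \<open>t \<ge> 0\<close> by (intro diff_right_mono mult_left_mono) (auto simp: t_def power2_eq_square)
  also have "\<dots> = (\<Sum>y\<in>F. 2 * t * real (card (D y)) - t\<^sup>2)"
    by (simp add: sum_subtractf sum_distrib_left)
  also have "\<dots> \<le> (\<Sum>y\<in>F. (real (card (D y)))\<^sup>2)"
  proof (rule sum_mono)
    fix y
    show "2 * t * real (card (D y)) - t\<^sup>2 \<le> (real (card (D y)))\<^sup>2"
      using zero_le_power2[of "real (card (D y)) - t"] by (simp add: power2_diff mult_ac)
  qed
  also note upper
  finally have "(4 * \<eta>\<^sup>2 * \<delta>\<^sup>2 * N) * (real N)\<^sup>2 \<le> 5 * (real N)\<^sup>2"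
    by (simp add: t_def power_mult_distrib power2_eq_square mult_ac)
  then show False using large N_pos by (simp add: N_def)
qed


section \<open>Placing all shifts\<close>

lemma four_cycle_packing:
  assumes V: "x \<in> V" "y \<in> V" "z \<in> V" "w \<in> V"
    and c: "c i = x + y" "c j = y + z" "c k = z + w" "c l = w + x"
    and nz: "\<forall>e\<in>{i, j, k, l}. c e \<noteq> 0 \<and> c e \<noteq> u"
    and diag: "x + z \<noteq> 0" "x + z \<noteq> u" "y + w \<noteq> 0" "y + w \<noteq> u" "x + y + z + w \<noteq> 0"
  shows "card {i, j, k, l} = 4"
    and "\<exists>p. packing c p {{i, j, k, l}} \<and> p ` {i, j, k, l} \<subseteq> {x, y, z, w}"
proof -
  have eq: "a = b" if "a + b = 0" for a b :: 'a using that add_eq_iff[of a b 0] by simp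
  have sums: "c i + c j = x + z" "c i + c k = x + y + z + w" "c i + c l = y + w"
    "c j + c k = y + w" "c j + c l = x + y + z + w" "c k + c l = x + z"
    unfolding c by (simp_all add: cancel)
  have "c i \<noteq> c j" "c i \<noteq> c k" "c i \<noteq> c l" "c j \<noteq> c k" "c j \<noteq> c l" "c k \<noteq> c l"
    using sums diag double by metis+
  then have dist: "i \<noteq> j" "i \<noteq> k" "i \<noteq> l" "j \<noteq> k" "j \<noteq> l" "k \<noteq> l" by auto
  then show "card {i, j, k, l} = 4" by simp
  define p where "p e = (if e = i then x else if e = j then y else if e = k then z else w)" for e
  have p: "p i = x" "p j = y" "p k = z" "p l = w" using dist by (auto simp: p_def)
  have "(\<lambda>e. p e + c e) ` {i, j, k, l} = {y, z, w, x}"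
    unfolding image_insert image_empty p c by (simp only: double_left)
  moreover have "p ` {i, j, k, l} = {x, y, z, w}" unfolding image_insert image_empty p ..
  moreover have "separated p {i, j, k, l}"
    using nz diag unfolding separated_def by (simp add: p c add.commute)
  ultimately have "packing c p {{i, j, k, l}}"
    using V by (simp add: packing_def insert_commute)
  with \<open>p ` {i, j, k, l} = {x, y, z, w}\<close>
  show "\<exists>p. packing c p {{i, j, k, l}} \<and> p ` {i, j, k, l} \<subseteq> {x, y, z, w}" by blast
qed

text \<open>
  As long as a positive proportion \<open>\<delta>\<close> of shifts is left, the free points outside \<open>R\<close> and its
  translate by \<open>u\<close> are still more than half of \<open>V\<close>, so one more four-cycle fits.
\<close>

lemma dense_packing_step:
  fixes \<eta> \<delta> :: real
  assumes fin: "finite J" and inj: "inj_on c J" and cV: "c ` J \<subseteq> V"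
    and nz: "\<forall>i\<in>J. c i \<noteq> 0 \<and> c i \<noteq> u"
    and nonneg: "0 \<le> \<eta>" "0 \<le> \<delta>" and large: "5 < 4 * \<eta>\<^sup>2 * \<delta>\<^sup>2 * card V"
    and RV: "R \<subseteq> V" and room: "2 * card J + 2 * card R \<le> (1/2 - \<eta>) * card V"
    and pack: "packing c a \<D>" "\<Union>\<D> \<subseteq> J" "occupied a (\<Union>\<D>) \<inter> R = {}"
    and rest: "\<delta> * card V \<le> card (J - \<Union>\<D>)"
  shows "\<exists>a' g. packing c a' (\<D> \<union> {g}) \<and> g \<subseteq> J - \<Union>\<D> \<and> card g = 4 \<and>
           occupied a' (\<Union>(\<D> \<union> {g})) \<inter> R = {}"
proof -
  define B where "B = occupied a (\<Union>\<D>) \<union> R \<union> (\<lambda>x. x + u) ` R"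
  define F where "F = V - B"
  define S where "S = c ` (J - \<Union>\<D>)"
  have finR: "finite R" using RV finite_V finite_subset by blast
  have finD: "finite (\<Union>\<D>)" using fin pack(2) finite_subset by blast
  have "card B \<le> card (occupied a (\<Union>\<D>) \<union> R) + card ((\<lambda>x. x + u) ` R)"
    unfolding B_def by (rule card_Un_le)
  also have "\<dots> \<le> (card (occupied a (\<Union>\<D>)) + card R) + card R"
    using finR by (intro add_mono card_Un_le card_image_le)
  also have "\<dots> \<le> 2 * card J + 2 * card R"
    using card_occupied_le[OF finD, of a] card_mono[OF fin pack(2)] by simp
  finally have "card B \<le> 2 * card J + 2 * card R" .
  moreover have "card V \<le> card F + card B"
  proof -
    have "finite B" unfolding B_def using finR finD by (simp add: finite_occupied)
    moreover have "V \<subseteq> F \<union> B" unfolding F_def by blast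
    moreover have "finite F" unfolding F_def using finite_V by simp
    ultimately have "card V \<le> card (F \<union> B)" by (intro card_mono) auto
    then show ?thesis using card_Un_le[of F B] by linarith
  qed
  ultimately have cardF: "(1/2 + \<eta>) * card V \<le> card F"
    using room by (simp add: algebra_simps)
  have "card S = card (J - \<Union>\<D>)"
    unfolding S_def by (intro card_image inj_on_subset[OF inj]) auto
  then have cardS: "\<delta> * card V \<le> card S" using rest by simp
  have "F \<subseteq> V" "S \<subseteq> V" using cV by (auto simp: F_def S_def)
  from dense_four_cycle[OF this nonneg cardF cardS large]
  obtain x y z w where F: "{x, y, z, w} \<subseteq> F" and cyc: "four_cycle S x y z w" by blast
  then have S: "x + y \<in> S" "y + z \<in> S" "z + w \<in> S" "w + x \<in> S"
    and diag: "x + z \<noteq> 0" "x + z \<noteq> u" "y + w \<noteq> 0" "y + w \<noteq> u" "x + y + z + w \<noteq> 0"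
    by (simp_all add: four_cycle_def)
  obtain i where i: "i \<in> J - \<Union>\<D>" "c i = x + y" using S(1) unfolding S_def by force
  obtain j where j: "j \<in> J - \<Union>\<D>" "c j = y + z" using S(2) unfolding S_def by force
  obtain k where k: "k \<in> J - \<Union>\<D>" "c k = z + w" using S(3) unfolding S_def by force
  obtain l where l: "l \<in> J - \<Union>\<D>" "c l = w + x" using S(4) unfolding S_def by force
  have ix: "{i, j, k, l} \<subseteq> J - \<Union>\<D>" using i j k l by simp
  note c = i(2) j(2) k(2) l(2)
  have V: "x \<in> V" "y \<in> V" "z \<in> V" "w \<in> V" using F \<open>F \<subseteq> V\<close> by blast+
  have nz': "\<forall>e\<in>{i, j, k, l}. c e \<noteq> 0 \<and> c e \<noteq> u" using nz ix by blast
  note cyc = four_cycle_packing[OF V c nz' diag]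
  define g where "g = {i, j, k, l}"
  obtain p where p: "packing c p {g}" "p ` g \<subseteq> {x, y, z, w}"
    using cyc(2) unfolding g_def by blast
  have pF: "p e \<in> F" if "e \<in> g" for e using p(2) that F by blast
  have gJ: "g \<subseteq> J - \<Union>\<D>" using ix by (simp add: g_def)
  define a' where "a' = (\<lambda>e. if e \<in> \<Union>{g} then p e else a e)"
  have pack': "packing c a' (\<D> \<union> {g})"
    unfolding a'_def
  proof (rule packing_union[OF pack(1) p(1)])
    show "\<Union>\<D> \<inter> \<Union>{g} = {}" using gJ by auto
    show "p e \<notin> occupied a {d}" if "d \<in> \<Union>\<D>" "e \<in> \<Union>{g}" for d e
    proof -
      have "p e \<notin> B" using pF[of e] that by (simp add: F_def)
      then show ?thesis using that by (auto simp: B_def occupied_def)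
    qed
  qed
  have "occupied a' (\<Union>\<D>) = occupied a (\<Union>\<D>)"
    using gJ by (intro occupied_cong) (auto simp: a'_def)
  moreover have "occupied a' g \<inter> R = {}"
  proof -
    have "p e \<notin> R \<and> p e + u \<notin> R" if "e \<in> g" for e
    proof -
      have "p e \<notin> R" "p e \<notin> (\<lambda>x. x + u) ` R" using pF[OF that] by (auto simp: F_def B_def)
      moreover have "p e = (p e + u) + u" by (simp add: add.assoc double)
      ultimately show ?thesis by blast
    qed
    then show ?thesis by (auto simp: occupied_def a'_def)
  qed
  ultimately have "occupied a' (\<Union>(\<D> \<union> {g})) \<inter> R = {}"
    using pack(3) by (simp add: occupied_Un Int_Un_distrib2)
  then show ?thesis using pack' gJ cyc(1) unfolding g_def by blast
qed

lemma dense_packing: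
  fixes \<eta> \<delta> :: real
  assumes fin: "finite J" and inj: "inj_on c J" and cV: "c ` J \<subseteq> V"
    and nz: "\<forall>i\<in>J. c i \<noteq> 0 \<and> c i \<noteq> u"
    and nonneg: "0 \<le> \<eta>" "0 \<le> \<delta>" and large: "5 < 4 * \<eta>\<^sup>2 * \<delta>\<^sup>2 * card V"
    and RV: "R \<subseteq> V" and room: "2 * card J + 2 * card R \<le> (1/2 - \<eta>) * card V"
  shows "\<exists>a \<D>. packing c a \<D> \<and> \<Union>\<D> \<subseteq> J \<and> (\<forall>g\<in>\<D>. card g = 4) \<and>
           occupied a (\<Union>\<D>) \<inter> R = {} \<and> card (J - \<Union>\<D>) < \<delta> * card V"
proof -
  define ok where "ok q \<longleftrightarrow> packing c (fst q) (snd q) \<and> \<Union>(snd q) \<subseteq> J \<and>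
    (\<forall>g\<in>snd q. card g = 4) \<and> occupied (fst q) (\<Union>(snd q)) \<inter> R = {}" for q
  have "ok (\<lambda>_. 0, {})"
    by (simp add: ok_def packing_def separated_def occupied_def)
  moreover have "\<forall>q. ok q \<longrightarrow> card (\<Union>(snd q)) < Suc (card J)"
    using card_mono[OF fin] by (auto simp: ok_def less_Suc_eq_le)
  ultimately have "\<exists>q. ok q \<and> (\<forall>q'. ok q' \<longrightarrow> card (\<Union>(snd q')) \<le> card (\<Union>(snd q)))"
    by (rule ex_has_greatest_nat)
  then obtain q where q: "ok q" "\<And>q'. ok q' \<Longrightarrow> card (\<Union>(snd q')) \<le> card (\<Union>(snd q))"
    by blast
  obtain a \<D> where q_eq: "q = (a, \<D>)" by (cases q)
  have pack: "packing c a \<D>" "\<Union>\<D> \<subseteq> J" "occupied a (\<Union>\<D>) \<inter> R = {}" "\<forall>g\<in>\<D>. card g = 4"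
    using q(1) by (auto simp: ok_def q_eq)
  have "\<not> \<delta> * card V \<le> card (J - \<Union>\<D>)"
  proof
    assume "\<delta> * card V \<le> card (J - \<Union>\<D>)"
    from dense_packing_step[OF fin inj cV nz nonneg large RV room pack(1-3) this]
    obtain a' g where g: "packing c a' (\<D> \<union> {g})" "g \<subseteq> J - \<Union>\<D>" "card g = 4"
      "occupied a' (\<Union>(\<D> \<union> {g})) \<inter> R = {}" by blast
    have "ok (a', \<D> \<union> {g})" using g pack by (auto simp: ok_def)
    then have "card (\<Union>(\<D> \<union> {g})) \<le> card (\<Union>\<D>)" using q(2) q_eq by fastforce
    moreover have "card (\<Union>(\<D> \<union> {g})) = card (\<Union>\<D>) + card g"
    proof -
      have "\<Union>(\<D> \<union> {g}) = \<Union>\<D> \<union> g" by auto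
      moreover have "finite (\<Union>\<D>)" "finite g" "\<Union>\<D> \<inter> g = {}"
        using fin pack(2) g(2) by (auto intro: finite_subset)
      ultimately show ?thesis by (simp add: card_Un_disjoint)
    qed
    ultimately show False using g(3) by simp
  qed
  then show ?thesis using pack by (intro exI[of _ a] exI[of _ \<D>]) simp
qed

text \<open>
  Without zero-sum quadruples (and with distinct shifts) the sums of pairs are distinct elements
  of \<open>V\<close>.
\<close>

lemma card_le_if_no_zero_sum_quadruple:
  assumes fin: "finite T" and inj: "inj_on c T" and cV: "c ` T \<subseteq> V"
    and none: "\<And>g. g \<subseteq> T \<Longrightarrow> card g = 4 \<Longrightarrow> sum c g \<noteq> 0"
  shows "card T * card T \<le> 4 * card V"
proof -
  let ?P = "{B. B \<subseteq> T \<and> card B = 2}"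
  have "inj_on (sum c) ?P"
  proof (rule inj_onI, rule ccontr)
    fix A B assume AB: "A \<in> ?P" "B \<in> ?P" "sum c A = sum c B" "A \<noteq> B"
    have finAB: "finite A" "finite B" using AB fin finite_subset by blast+
    show False
    proof (cases "A \<inter> B = {}")
      case True
      then have "sum c (A \<union> B) = 0"
        using finAB AB by (simp add: sum.union_disjoint double)
      moreover have "card (A \<union> B) = 4" using True finAB AB by (simp add: card_Un_disjoint)
      ultimately show False using none[of "A \<union> B"] AB by blast
    next
      case False
      then obtain i where i: "i \<in> A" "i \<in> B" by blast
      obtain j where j: "A = {i, j}" "j \<noteq> i"
        using AB i(1) by (auto simp: card_2_iff)
      obtain k where k: "B = {i, k}" "k \<noteq> i"
        using AB i(2) by (auto simp: card_2_iff)
      have "c j = c k" using AB(3) j k by simp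
      then have "j = k" using inj AB(1,2) j k by (auto simp: inj_on_def)
      then show False using AB(4) j k by simp
    qed
  qed
  moreover have "sum c ` ?P \<subseteq> V"
    using cV add_V by (auto simp: card_2_iff image_subset_iff)
  ultimately have "card ?P \<le> card V" using card_inj_on_le finite_V by blast
  then have "card T choose 2 \<le> card V" using n_subsets[OF fin, of 2] by simp
  then have le: "card T * (card T - 1) div 2 \<le> card V" by (simp add: choose_two)
  have V1: "1 \<le> card V" using zero_V finite_V by (metis card_gt_0_iff empty_iff less_eq_Suc_le One_nat_def)
  have "t * t \<le> 4 * N" if "t * (t - 1) div 2 \<le> N" "1 \<le> N" for t N :: nat
  proof (cases "t \<le> 1")
    case True
    then have "t * t \<le> 1 * 1" by (intro mult_mono) auto
    then show ?thesis using that(2) by linarith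
  next
    case False
    have "even (t * (t - 1))" by (cases "even t") simp_all
    then have "2 * (t * (t - 1) div 2) = t * (t - 1)" by simp
    moreover have "t * t \<le> t * (2 * (t - 1))" using False by (intro mult_le_mono2) simp
    ultimately show ?thesis using that(1) by linarith
  qed
  then show ?thesis using le V1 by blast
qed

lemma minimal_zero_sum_pair:
  assumes "i \<noteq> j" "c i = c j" "c i \<noteq> 0"
  shows "minimal_zero_sum c {i, j}"
proof -
  have "sum c B \<noteq> 0" if B: "B \<subset> {i, j}" "B \<noteq> {}" for B
  proof -
    have "B = {i} \<or> B = {j}" using B by (cases "i \<in> B"; cases "j \<in> B") auto
    then show ?thesis using assms(2,3) by auto
  qed
  moreover have "sum c {i, j} = 0" using assms(1,2) by (simp add: double)
  ultimately show ?thesis by (simp add: minimal_zero_sum_def)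
qed

lemma minimal_zero_sum_quadruple:
  assumes "card g = 4" "sum c g = 0" "inj_on c g" "\<forall>i\<in>g. c i \<noteq> 0"
  shows "minimal_zero_sum c g"
proof -
  have fin: "finite g" using assms(1) by (metis card.infinite zero_neq_numeral)
  have pos: "sum c B \<noteq> 0" if "B \<subseteq> g" "card B = 1 \<or> card B = 2" for B
    using that(2)
  proof
    assume "card B = 1"
    then obtain i where "B = {i}" by (auto simp: card_1_singleton_iff)
    then show ?thesis using assms(4) that(1) by simp
  next
    assume "card B = 2"
    then obtain i j where B: "B = {i, j}" "i \<noteq> j" by (auto simp: card_2_iff)
    then have "c i \<noteq> c j" using assms(3) that(1) by (auto simp: inj_on_def)
    then show ?thesis using B by (simp add: add_eq_iff)
  qed
  have "sum c B \<noteq> 0" if B: "B \<subset> g" "B \<noteq> {}" for B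
  proof
    assume 0: "sum c B = 0"
    have finB: "finite B" using B fin finite_subset by blast
    have "0 < card B" "card B < 4"
      using B finB fin psubset_card_mono[OF fin B(1)] assms(1) by (auto simp: card_gt_0_iff)
    moreover have "card B \<noteq> 1" "card B \<noteq> 2" using pos[of B] B 0 by auto
    ultimately have "card B = 3" by linarith
    then have "card (g - B) = 1" using B finB assms(1) by (simp add: card_Diff_subset)
    then have "sum c (g - B) \<noteq> 0" by (intro pos) auto
    moreover have "sum c (g - B) = 0"
      using sum_diff[OF fin, of B c] B 0 assms(2) by auto
    ultimately show False by blast
  qed
  then show ?thesis using fin assms by (auto simp: minimal_zero_sum_def)
qed


text \<open>
  A family that is small compared with \<open>V\<close> is placed greedily after splitting it into minimal
  zero-sum sets, whose length is at most \<open>L\<close> because \<open>V\<close> has fewer than \<open>2 ^ L\<close> elements.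
\<close>

lemma packing_of_zero_sum_family:
  assumes fin: "finite T" and cV: "c ` T \<subseteq> V" and nz: "\<forall>i\<in>T. c i \<noteq> 0 \<and> c i \<noteq> u"
    and zero: "sum c T = 0" and L: "card V < 2 ^ L" "L * (2 * card T) < card V"
  shows "\<exists>a \<T>. packing c a \<T> \<and> \<Union>\<T> = T"
proof -
  obtain \<T> where \<T>: "disjoint \<T>" "\<forall>g\<in>\<T>. g \<subseteq> T \<and> g \<noteq> {} \<and> minimal_zero_sum c g"
    "\<forall>g. g \<subseteq> T - \<Union>\<T> \<longrightarrow> g \<noteq> {} \<longrightarrow> \<not> minimal_zero_sum c g"
    using maximal_disjoint_subfamily[OF fin, of "minimal_zero_sum c"] by blast
  have "sum c (T - \<Union>\<T>) = sum c T"
    using \<T>(2) by (intro sum_diff_zero_subfamily fin \<T>(1)) (auto simp: minimal_zero_sum_def)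
  then have zero': "sum c (T - \<Union>\<T>) = 0" using zero by simp
  have "T - \<Union>\<T> = {}"
  proof (rule ccontr)
    assume "T - \<Union>\<T> \<noteq> {}"
    then obtain g where g: "g \<subseteq> T - \<Union>\<T>" "minimal_zero_sum c g"
      using minimal_zero_sum_exists[OF finite_Diff[OF fin] _ zero'] by blast
    then have "g \<noteq> {}" by (simp add: minimal_zero_sum_def)
    then show False using \<T>(3) g by blast
  qed
  then have union: "\<Union>\<T> = T" using \<T>(2) by blast
  have "finite \<T>" using union fin finite_UnionD by blast
  have "\<exists>a'. packing c a' ({} \<union> \<T>) \<and> (\<forall>i\<in>\<Union>{}. a' i = (0::'a))"
  proof (rule greedy_extension[where R = V and K = "card V" and L = L])
    show "\<forall>g\<in>\<T>. finite g \<and> card g \<le> L \<and>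
            (\<exists>p. packing c p {g} \<and> card V \<le> card {x \<in> V. \<forall>i\<in>g. x + p i \<in> V})"
    proof
      fix g assume g: "g \<in> \<T>"
      then have min: "minimal_zero_sum c g" and gT: "g \<subseteq> T" using \<T>(2) by auto
      have cg: "c ` g \<subseteq> V" using cV gT by blast
      then have "(2::nat) ^ (card g - 1) < 2 ^ L"
        using minimal_zero_sum_card[OF min] L(1) by linarith
      then have "card g - 1 < L" by (rule power_less_imp_less_exp[rotated]) simp
      then have "card g \<le> L" by simp
      moreover obtain p where p: "packing c p {g}"
        using minimal_zero_sum_packing[OF min cg] nz gT by blast
      moreover have "{x \<in> V. \<forall>i\<in>g. x + p i \<in> V} = V"
        using p add_V by (auto simp: packing_def)
      moreover have "finite g" using gT fin finite_subset by blast
      ultimately show "finite g \<and> card g \<le> L \<and>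
            (\<exists>p. packing c p {g} \<and> card V \<le> card {x \<in> V. \<forall>i\<in>g. x + p i \<in> V})"
        by (intro conjI exI[of _ p]) simp_all
    qed
    show "L * (card (occupied (\<lambda>_. 0) (\<Union>{}) \<inter> V) + 2 * card (\<Union>\<T>)) < card V"
      using L(2) by (simp add: union occupied_def)
  qed (use \<open>finite \<T>\<close> \<T>(1) in \<open>simp_all add: packing_def separated_def\<close>)
  then obtain a' where "packing c a' \<T>" by auto
  then show ?thesis using union by blast
qed

text \<open>
  Each point of \<open>W\<close> is hit by at most one index, hence belongs to at most one group.
\<close>

lemma card_conflicting_groups:
  assumes fin: "finite (\<Union>\<D>)" and pack: "packing c a \<D>" and four: "\<forall>g\<in>\<D>. card g = 4"
    and W: "finite W"
  shows "card (\<Union>{g\<in>\<D>. a ` g \<inter> W \<noteq> {}}) \<le> 4 * card W"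
proof -
  let ?C = "{g\<in>\<D>. a ` g \<inter> W \<noteq> {}}"
  have finD: "finite \<D>" using fin finite_UnionD by blast
  obtain f where f: "\<forall>g\<in>?C. f g \<in> g \<and> a (f g) \<in> W"
    by (rule that[of "\<lambda>g. SOME i. i \<in> g \<and> a i \<in> W"]) (auto intro: someI2)
  have inj_a: "inj_on a (\<Union>\<D>)"
    using pack separated_inj_on unfolding packing_def by blast
  have disj: "disjoint \<D>" using pack unfolding packing_def by blast
  have "inj_on (\<lambda>g. a (f g)) ?C"
  proof (rule inj_onI)
    fix g h assume gh: "g \<in> ?C" "h \<in> ?C" "a (f g) = a (f h)"
    then have "f g = f h" using f inj_onD[OF inj_a, of "f g" "f h"] by blast
    moreover have "f g \<in> g" "f h \<in> h" using f gh by blast+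
    ultimately have "f g \<in> g \<inter> h" by simp
    then show "g = h" using disjointD[OF disj, of g h] gh by blast
  qed
  then have card_C: "card ?C \<le> card W"
    by (rule card_inj_on_le) (use f W in auto)
  have "card (\<Union>?C) \<le> (\<Sum>g\<in>?C. card g)"
    by (rule card_Union_le_sum_card)
  also have "\<dots> = 4 * card ?C" using four by simp
  finally show ?thesis using card_C by simp
qed

text \<open>
  The case of distinct shifts. The four-cycles \<open>\<D>\<close> of the dense stage avoid the reserve \<open>R\<close>. Of the
  few shifts that remain, as many zero-sum quadruples \<open>\<S>\<close> as possible are formed; the rest \<open>T\<close> has
  at most \<open>2 * sqrt (card V)\<close> elements but may need cycles of unbounded length, for which no region
  can be reserved in advance. It is therefore placed as if \<open>\<D>\<close> were absent. This displaces a small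
  subfamily \<open>\<C>\<close> of \<open>\<D>\<close>, and all groups in \<open>\<C>\<close> and \<open>\<S>\<close> have four elements and fit into \<open>R\<close>.

  In the last hypothesis \<open>t\<close> stands for the size of \<open>T\<close>: it occupies at most \<open>2 * t\<close> points and
  displaces at most \<open>8 * t\<close> shifts, so the greedy bound for groups of four is
  \<open>4 * (2 * t + 2 * (8 * t + \<delta> * card V)) < K\<close>.
\<close>

lemma packing_exists_inj:
  fixes \<eta> \<delta> :: real
  assumes fin: "finite J" and inj: "inj_on c J" and cV: "c ` J \<subseteq> V"
    and nz: "\<forall>i\<in>J. c i \<noteq> 0 \<and> c i \<noteq> u" and zero: "sum c J = 0"
    and nonneg: "0 \<le> \<eta>" "0 \<le> \<delta>" and large: "5 < 4 * \<eta>\<^sup>2 * \<delta>\<^sup>2 * card V"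
    and RV: "R \<subseteq> V" and room: "2 * card J + 2 * card R \<le> (1/2 - \<eta>) * card V"
    and reserve: "\<And>(g::'i set) p. card g = 4 \<Longrightarrow> p ` g \<subseteq> V \<Longrightarrow>
      K \<le> card {x\<in>V. \<forall>i\<in>g. x + p i \<in> R}"
    and L: "card V < 2 ^ L"
    and sparse: "\<And>t. t * t \<le> 4 * card V \<Longrightarrow>
      L * (2 * t) < card V \<and> 72 * real t + 8 * \<delta> * card V < K"
  shows "\<exists>a \<G>. packing c a \<G> \<and> \<Union>\<G> = (J::'i set)"
proof -
  obtain b \<D> where D: "packing c b \<D>" "\<Union>\<D> \<subseteq> J" "\<forall>g\<in>\<D>. card g = 4"
    "occupied b (\<Union>\<D>) \<inter> R = {}" "card (J - \<Union>\<D>) < \<delta> * card V"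
    using dense_packing[OF fin inj cV nz nonneg large RV room] by blast
  define J' where "J' = J - \<Union>\<D>"
  have finJ': "finite J'" using fin by (simp add: J'_def)
  have "sum c J' = sum c J"
    unfolding J'_def using D(2) packing_sum_eq_0[OF D(1)] D(1)
    by (intro sum_diff_zero_subfamily fin) (auto simp: packing_def)
  then have zero': "sum c J' = 0" using zero by simp
  obtain \<S> where S: "disjoint \<S>" "\<forall>g\<in>\<S>. g \<subseteq> J' \<and> g \<noteq> {} \<and> card g = 4 \<and> sum c g = 0"
    "\<forall>g. g \<subseteq> J' - \<Union>\<S> \<longrightarrow> g \<noteq> {} \<longrightarrow> \<not> (card g = 4 \<and> sum c g = 0)"
    using maximal_disjoint_subfamily[OF finJ', of "\<lambda>g. card g = 4 \<and> sum c g = 0"] by blast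
  define T where "T = J' - \<Union>\<S>"
  have TJ: "T \<subseteq> J" "finite T" using fin by (auto simp: T_def J'_def)
  have "sum c T = sum c J'"
    unfolding T_def using S(2) by (intro sum_diff_zero_subfamily finJ' S(1)) blast
  then have zeroT: "sum c T = 0" using zero' by simp
  have "card T * card T \<le> 4 * card V"
  proof (rule card_le_if_no_zero_sum_quadruple)
    show "finite T" "inj_on c T" "c ` T \<subseteq> V"
      using TJ cV inj_on_subset[OF inj] by blast+
    show "sum c g \<noteq> 0" if "g \<subseteq> T" "card g = 4" for g
    proof -
      have "g \<noteq> {}" using that(2) by auto
      then show ?thesis using S(3) that unfolding T_def by blast
    qed
  qed
  then have t: "L * (2 * card T) < card V" "72 * real (card T) + 8 * \<delta> * card V < K"
    using sparse by blast+
  have "c ` T \<subseteq> V" "\<forall>i\<in>T. c i \<noteq> 0 \<and> c i \<noteq> u" using cV nz TJ(1) by blast+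
  from packing_of_zero_sum_family[OF TJ(2) this zeroT L t(1)]
  obtain a\<^sub>T \<T> where T: "packing c a\<^sub>T \<T>" "\<Union>\<T> = T" by blast
  define W where "W = occupied a\<^sub>T T"
  have finW: "finite W" unfolding W_def using TJ(2) by (rule finite_occupied)
  have cardW: "card W \<le> 2 * card T" unfolding W_def using TJ(2) by (rule card_occupied_le)
  define \<C> where "\<C> = {g\<in>\<D>. b ` g \<inter> W \<noteq> {}}"
  have CD: "\<C> \<subseteq> \<D>" by (auto simp: \<C>_def)
  have finD: "finite (\<Union>\<D>)" using D(2) fin finite_subset by blast
  have "card (\<Union>\<C>) \<le> 4 * card W"
    unfolding \<C>_def by (rule card_conflicting_groups[OF finD D(1,3) finW])
  then have cardC: "card (\<Union>\<C>) \<le> 8 * card T" using cardW by linarith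
  have disjD: "disjoint \<D>" using D(1) by (simp add: packing_def)
  have CDdisj: "\<Union>(\<D> - \<C>) \<inter> \<Union>\<C> = {}"
    using disjD CD unfolding disjoint_def by fast
  define a where "a = (\<lambda>i. if i \<in> \<Union>(\<D> - \<C>) then b i else a\<^sub>T i)"
  have TD: "T \<inter> \<Union>\<D> = {}" by (auto simp: T_def J'_def)
  have pack: "packing c a (\<T> \<union> (\<D> - \<C>))"
    unfolding a_def
  proof (rule packing_union[OF T(1) packing_subfamily[OF D(1)]])
    show "\<D> - \<C> \<subseteq> \<D>" by blast
    show "\<Union>\<T> \<inter> \<Union>(\<D> - \<C>) = {}" using TD T(2) by blast
    show "b j \<notin> occupied a\<^sub>T {i}" if "i \<in> \<Union>\<T>" "j \<in> \<Union>(\<D> - \<C>)" for i j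
    proof -
      have "b j \<notin> W" using that(2) by (auto simp: \<C>_def)
      then show ?thesis using that(1) T(2) by (auto simp: W_def occupied_def)
    qed
  qed
  have occ: "occupied a (\<Union>(\<T> \<union> (\<D> - \<C>))) \<inter> R \<subseteq> W"
  proof -
    have "occupied a (\<Union>\<T>) = W"
      unfolding W_def T(2) using TD by (intro occupied_cong) (auto simp: a_def)
    moreover have "occupied a (\<Union>(\<D> - \<C>)) = occupied b (\<Union>(\<D> - \<C>))"
      by (intro occupied_cong) (simp add: a_def)
    moreover have "\<dots> \<subseteq> occupied b (\<Union>\<D>)" by (auto simp: occupied_def)
    ultimately show ?thesis using D(4) unfolding Union_Un_distrib occupied_Un by blast
  qed
  define \<H> where "\<H> = \<C> \<union> \<S>"
  have SJ: "\<Union>\<S> \<subseteq> J'" using S(2) by blast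
  have CJ: "\<Union>\<C> \<inter> J' = {}" using CD by (auto simp: J'_def)
  have "card (\<Union>\<H>) \<le> card (\<Union>\<C>) + card (\<Union>\<S>)"
    unfolding \<H>_def Union_Un_distrib by (rule card_Un_le)
  also have "\<dots> \<le> 8 * card T + card J'"
    using cardC card_mono[OF finJ' SJ] by linarith
  finally have cardH: "real (card (\<Union>\<H>)) \<le> 8 * real (card T) + \<delta> * card V"
    using D(5) unfolding J'_def by linarith
  have finH: "finite (\<Union>\<H>)"
    unfolding \<H>_def Union_Un_distrib
    using finite_subset[OF Union_mono[OF CD] finD] finite_subset[OF SJ finJ'] by simp
  have "\<exists>a'. packing c a' ((\<T> \<union> (\<D> - \<C>)) \<union> \<H>) \<and>
      (\<forall>i\<in>\<Union>(\<T> \<union> (\<D> - \<C>)). a' i = a i)"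
  proof (rule greedy_extension[where R = R and K = K and L = 4, OF _ pack])
    show "finite \<H>" using finH finite_UnionD by blast
    show "finite (\<Union>(\<T> \<union> (\<D> - \<C>)))"
      unfolding Union_Un_distrib T(2) using TJ(2) finD by (auto intro: finite_subset)
    show "disjoint \<H>"
      unfolding \<H>_def
    proof (rule disjoint_union)
      show "disjoint \<C>" using pairwise_subset disjD CD by blast
      show "\<Union>\<C> \<inter> \<Union>\<S> = {}" using CJ SJ by blast
    qed (rule S(1))
    have "\<Union>(\<D> - \<C>) \<inter> \<Union>\<S> = {}" using SJ unfolding J'_def by blast
    moreover have "T \<inter> \<Union>\<S> = {}" unfolding T_def by blast
    moreover have "T \<inter> \<Union>\<C> = {}" using TD CD by blast
    ultimately show "\<Union>(\<T> \<union> (\<D> - \<C>)) \<inter> \<Union>\<H> = {}"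
      using CDdisj unfolding Union_Un_distrib \<H>_def T(2) Int_Un_distrib Int_Un_distrib2 by simp
    show "\<forall>g\<in>\<H>. finite g \<and> card g \<le> 4 \<and>
            (\<exists>p. packing c p {g} \<and> K \<le> card {x \<in> V. \<forall>i\<in>g. x + p i \<in> R})"
    proof
      fix g assume g: "g \<in> \<H>"
      have "card g = 4" using g D(3) CD S(2) by (auto simp: \<H>_def)
      moreover have "finite g" by (rule finite_subset[OF Union_upper[OF g] finH])
      moreover have "\<exists>p. packing c p {g}"
      proof (cases "g \<in> \<C>")
        case True
        then show ?thesis using packing_subfamily[OF D(1), of "{g}"] CD by blast
      next
        case False
        then have g: "g \<subseteq> J'" "card g = 4" "sum c g = 0" using g S(2) by (auto simp: \<H>_def)
        then have gJ: "g \<subseteq> J" by (auto simp: J'_def)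
        have "minimal_zero_sum c g"
          using minimal_zero_sum_quadruple[OF g(2,3)] inj_on_subset[OF inj gJ] nz gJ by blast
        then show ?thesis using minimal_zero_sum_packing[of c g] cV nz gJ by blast
      qed
      ultimately show "finite g \<and> card g \<le> 4 \<and>
          (\<exists>p. packing c p {g} \<and> K \<le> card {x \<in> V. \<forall>i\<in>g. x + p i \<in> R})"
        using reserve[of g] by (auto simp: packing_def)
    qed
    have "card (occupied a (\<Union>(\<T> \<union> (\<D> - \<C>))) \<inter> R) \<le> 2 * card T"
      using card_mono[OF finW occ] cardW by linarith
    then have "real (4 * (card (occupied a (\<Union>(\<T> \<union> (\<D> - \<C>))) \<inter> R) + 2 * card (\<Union>\<H>))) < K"
      using cardH t(2) by simp
    then show "4 * (card (occupied a (\<Union>(\<T> \<union> (\<D> - \<C>))) \<inter> R) + 2 * card (\<Union>\<H>)) < K"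
      by (simp only: of_nat_less_iff)
  qed
  then obtain a' where "packing c a' ((\<T> \<union> (\<D> - \<C>)) \<union> \<H>)" by blast
  moreover have "\<Union>((\<T> \<union> (\<D> - \<C>)) \<union> \<H>) = J"
  proof -
    have "\<Union>((\<T> \<union> (\<D> - \<C>)) \<union> \<H>) = T \<union> (\<Union>\<D> \<union> \<Union>\<S>)"
      using CD T(2) unfolding \<H>_def by blast
    also have "\<dots> = J" using SJ D(2) by (auto simp: T_def J'_def)
    finally show ?thesis .
  qed
  ultimately show ?thesis by blast
qed

text \<open>
  Equal shifts are grouped in pairs and placed last. A pair has only two points, so the greedy bound
  needs no more than that the occupied points stay below half of \<open>V\<close> in the end; the remaining
  shifts are distinct.
\<close>

lemma packing_exists:
  fixes \<eta> \<delta> :: real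
  assumes fin: "finite I" and cV: "c ` I \<subseteq> V"
    and nz: "\<forall>i\<in>I. c i \<noteq> 0 \<and> c i \<noteq> u" and zero: "sum c I = 0"
    and nonneg: "0 < \<eta>" "0 \<le> \<delta>" and large: "5 < 4 * \<eta>\<^sup>2 * \<delta>\<^sup>2 * card V"
    and RV: "R \<subseteq> V" and room: "2 * card I + 2 * card R \<le> (1/2 - \<eta>) * card V"
    and reserve: "\<And>(g::'i set) p. card g = 4 \<Longrightarrow> p ` g \<subseteq> V \<Longrightarrow>
      K \<le> card {x\<in>V. \<forall>i\<in>g. x + p i \<in> R}"
    and L: "card V < 2 ^ L"
    and sparse: "\<And>t. t * t \<le> 4 * card V \<Longrightarrow>
      L * (2 * t) < card V \<and> 72 * real t + 8 * \<delta> * card V < K"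
  shows "\<exists>a \<G>. packing c a \<G> \<and> \<Union>\<G> = (I::'i set)"
proof -
  define twin where "twin g \<longleftrightarrow> (\<exists>i j. g = {i, j} \<and> i \<noteq> j \<and> c i = c j)" for g
  obtain \<P> where P: "disjoint \<P>" "\<forall>g\<in>\<P>. g \<subseteq> I \<and> g \<noteq> {} \<and> twin g"
    "\<forall>g. g \<subseteq> I - \<Union>\<P> \<longrightarrow> g \<noteq> {} \<longrightarrow> \<not> twin g"
    using maximal_disjoint_subfamily[OF fin, of twin] by blast
  have twin_sum: "sum c g = 0" "card g = 2" if "twin g" for g
    using that by (auto simp: twin_def double)
  define J where "J = I - \<Union>\<P>"
  have JI: "J \<subseteq> I" "finite J" using fin by (auto simp: J_def)
  have "inj_on c J"
  proof (rule inj_onI, rule ccontr)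
    fix i j assume "i \<in> J" "j \<in> J" "c i = c j" "i \<noteq> j"
    then have "twin {i, j}" "{i, j} \<subseteq> I - \<Union>\<P>" by (auto simp: twin_def J_def)
    then show False using P(3) by blast
  qed
  moreover have "sum c J = 0"
    unfolding J_def using P(2) twin_sum zero
    by (subst sum_diff_zero_subfamily[OF fin P(1)]) auto
  moreover have "2 * card J + 2 * card R \<le> (1/2 - \<eta>) * card V"
    using room card_mono[OF fin JI(1)] by linarith
  moreover have "c ` J \<subseteq> V" "\<forall>i\<in>J. c i \<noteq> 0 \<and> c i \<noteq> u" using cV nz JI by blast+
  ultimately have "\<exists>a \<G>. packing c a \<G> \<and> \<Union>\<G> = J"
    using nonneg(1) by (intro packing_exists_inj[where R = R and K = K and L = L,
      OF JI(2) _ _ _ _ _ nonneg(2) large RV _ reserve L sparse]) simp_all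
  then obtain a \<G> where G: "packing c a \<G>" "\<Union>\<G> = J" by blast
  have PI: "\<Union>\<P> \<subseteq> I" using P(2) by blast
  have finP: "finite (\<Union>\<P>)" using PI fin finite_subset by blast
  have "\<exists>a'. packing c a' (\<G> \<union> \<P>) \<and> (\<forall>i\<in>\<Union>\<G>. a' i = a i)"
  proof (rule greedy_extension[where R = V and K = "card V" and L = 2, OF _ G(1)])
    show "finite \<P>" using finP finite_UnionD by blast
    show "finite (\<Union>\<G>)" using G(2) JI(2) by simp
    show "disjoint \<P>" by (rule P(1))
    show "\<Union>\<G> \<inter> \<Union>\<P> = {}" unfolding G(2) J_def by blast
    show "\<forall>g\<in>\<P>. finite g \<and> card g \<le> 2 \<and>
            (\<exists>p. packing c p {g} \<and> card V \<le> card {x \<in> V. \<forall>i\<in>g. x + p i \<in> V})"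
    proof
      fix g assume g: "g \<in> \<P>"
      then have gI: "g \<subseteq> I" "twin g" using P(2) by auto
      then obtain i j where ij: "g = {i, j}" "i \<noteq> j" "c i = c j" by (auto simp: twin_def)
      then have "minimal_zero_sum c g" using minimal_zero_sum_pair[of i j c] nz gI by simp
      then obtain p where p: "packing c p {g}"
        using minimal_zero_sum_packing[of c g] cV nz gI(1) by blast
      moreover have "{x \<in> V. \<forall>i\<in>g. x + p i \<in> V} = V"
        using p add_V by (auto simp: packing_def)
      ultimately show "finite g \<and> card g \<le> 2 \<and>
            (\<exists>p. packing c p {g} \<and> card V \<le> card {x \<in> V. \<forall>i\<in>g. x + p i \<in> V})"
        using ij by (auto intro!: exI[of _ p])
    qed
    have "card (occupied a (\<Union>\<G>) \<inter> V) \<le> 2 * card J"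
      using card_occupied_le[OF JI(2), of a] G(2) finite_occupied[OF JI(2), of a]
        card_mono[of "occupied a J" "occupied a J \<inter> V"] by auto
    moreover have "card I = card J + card (\<Union>\<P>)"
      using card_Diff_subset[OF finP PI] card_mono[OF fin PI] by (simp add: J_def)
    moreover have "4 * card I < card V"
    proof -
      have "0 < card V" using zero_V finite_V card_gt_0_iff by blast
      then have "(1/2 - \<eta>) * card V < 1/2 * card V" using nonneg by (intro mult_strict_right_mono) auto
      then have "real (4 * card I) < real (card V)" using room by simp
      then show ?thesis by (simp only: of_nat_less_iff)
    qed
    ultimately show "2 * (card (occupied a (\<Union>\<G>) \<inter> V) + 2 * card (\<Union>\<P>)) < card V"
      by simp
  qed
  then obtain a' where "packing c a' (\<G> \<union> \<P>)" by blast
  moreover have "\<Union>(\<G> \<union> \<P>) = I" using G(2) PI by (auto simp: J_def)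
  ultimately show ?thesis by blast
qed


section \<open>From packings to pairings\<close>

lemma sum_constant_even:
  assumes "even (card A)"
  shows "(\<Sum>_\<in>A. x) = (0::'a)"
proof (cases "finite A")
  case True
  then have "(\<Sum>_\<in>A. x) = (if even (card A) then 0 else x)"
    by (induction A) (simp_all add: double)
  then show ?thesis using assms by simp
qed simp

text \<open>
  With \<open>d i = c i + u\<close> the second elements \<open>a i + d i\<close> run through the translate by \<open>u\<close> of the
  points \<open>a i\<close>, because adding \<open>c i\<close> only permutes these. So the pairs fill whole cosets of
  \<open>{0, u}\<close>, and the remaining cosets are the pairs with difference \<open>u\<close>.
\<close>

lemma pairing_of_packing:
  assumes fin: "finite M" and card: "2 * card M = card V" and IM: "I \<subseteq> M"
    and pack: "packing c a \<G>" "\<Union>\<G> = I"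
    and d: "\<forall>i\<in>I. d i = c i + u" "\<forall>i\<in>M - I. d i = u"
  shows "\<exists>a b. (\<forall>i\<in>M. a i \<noteq> b i \<and> a i + b i = d i) \<and>
           disjoint_family_on (\<lambda>i. {a i, b i}) M \<and> (\<Union>i\<in>M. {a i, b i}) = V"
proof -
  have finI: "finite I" using fin IM finite_subset by blast
  have sep: "separated a I" using pack by (simp add: packing_def)
  have inj: "inj_on a I" by (rule separated_inj_on[OF sep])
  have aV: "a ` I \<subseteq> V" using pack by (auto simp: packing_def)
  have im: "(\<lambda>i. a i + c i) ` I = a ` I"
  proof -
    have "(\<lambda>i. a i + c i) ` I = (\<Union>g\<in>\<G>. (\<lambda>i. a i + c i) ` g)" using pack(2) by blast
    also have "\<dots> = (\<Union>g\<in>\<G>. a ` g)" using pack(1) by (simp add: packing_def)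
    also have "\<dots> = a ` I" using pack(2) by blast
    finally show ?thesis .
  qed
  then have inj': "inj_on (\<lambda>i. a i + c i) I"
    using finI inj by (metis card_image eq_card_imp_inj_on)
  have opp: "a i \<noteq> a j + u" if "i \<in> I" "j \<in> I" for i j
  proof
    assume "a i = a j + u"
    then have "a i + a j = u" by (simp add: cancel)
    then show False using sep that u_nonzero double by (cases "i = j") (auto simp: separated_def)
  qed
  have opp': "a i \<noteq> a j + c j + u" if "i \<in> I" "j \<in> I" for i j
  proof -
    have "a j + c j \<in> a ` I" using im that(2) by blast
    then obtain k where "k \<in> I" "a j + c j = a k" by blast
    then show ?thesis using opp[OF that(1)] by simp
  qed
  define O\<^sub>I where "O\<^sub>I = occupied a I"
  have union_I: "(\<Union>i\<in>I. {a i, a i + c i + u}) = O\<^sub>I"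
  proof -
    have "(\<Union>i\<in>I. {a i, a i + c i + u}) = a ` I \<union> (\<lambda>x. x + u) ` (\<lambda>i. a i + c i) ` I"
      by blast
    also have "\<dots> = a ` I \<union> (\<lambda>x. x + u) ` a ` I" by (simp only: im)
    finally show ?thesis by (simp add: O\<^sub>I_def occupied_def image_image)
  qed
  have OV: "O\<^sub>I \<subseteq> V" using aV add_V u_V by (auto simp: O\<^sub>I_def occupied_def)
  have card_O: "card O\<^sub>I = 2 * card I"
  proof -
    have "a ` I \<inter> (\<lambda>i. a i + u) ` I = {}" using opp by blast
    moreover have "inj_on (\<lambda>i. a i + u) I" using inj by (simp add: inj_on_def)
    ultimately show ?thesis
      unfolding O\<^sub>I_def occupied_def using finI inj by (simp add: card_Un_disjoint card_image)
  qed
  define W where "W = V - O\<^sub>I"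
  have finW: "finite W" using finite_V by (simp add: W_def)
  have W_u: "x + u \<in> W" if "x \<in> W" for x
  proof -
    have "x \<in> O\<^sub>I" if "x + u \<in> O\<^sub>I"
    proof -
      from that obtain i where "i \<in> I" "x + u = a i \<or> x + u = a i + u"
        by (auto simp: O\<^sub>I_def occupied_def)
      then have "i \<in> I" "x = a i + u \<or> x = a i"
        using add_eq_iff[of x u "a i"] by (auto simp: add.commute)
      then show ?thesis by (auto simp: O\<^sub>I_def occupied_def)
    qed
    then show ?thesis using that add_V u_V by (auto simp: W_def)
  qed
  define coset where "coset g \<longleftrightarrow> (\<exists>x. g = {x, x + u})" for g
  obtain \<Q> where Q: "disjoint \<Q>" "\<forall>g\<in>\<Q>. g \<subseteq> W \<and> g \<noteq> {} \<and> coset g"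
    "\<forall>g. g \<subseteq> W - \<Union>\<Q> \<longrightarrow> g \<noteq> {} \<longrightarrow> \<not> coset g"
    using maximal_disjoint_subfamily[OF finW, of coset] by blast
  have coset_eq: "g = {x, x + u}" if "coset g" "x \<in> g" for g x
    using that by (auto simp: coset_def add.assoc double)
  have union_Q: "\<Union>\<Q> = W"
  proof (rule ccontr)
    assume "\<Union>\<Q> \<noteq> W"
    then obtain x where x: "x \<in> W" "x \<notin> \<Union>\<Q>" using Q(2) by blast
    have "x + u \<notin> \<Union>\<Q>"
    proof
      assume "x + u \<in> \<Union>\<Q>"
      then obtain g where g: "g \<in> \<Q>" "x + u \<in> g" by blast
      then have "g = {x + u, x + u + u}" using Q(2) coset_eq by blast
      then have "x \<in> g" by (simp add: add.assoc double)
      then show False using g x(2) by blast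
    qed
    then have "{x, x + u} \<subseteq> W - \<Union>\<Q>" using x W_u by simp
    then show False using Q(3) unfolding coset_def by blast
  qed
  have finQ: "finite \<Q>" using finW union_Q finite_UnionD by blast
  have "card W = 2 * card \<Q>"
  proof -
    have "card g = 2" if "g \<in> \<Q>" for g
      using that Q(2) u_nonzero by (auto simp: coset_def)
    moreover have "card (\<Union>\<Q>) = sum card \<Q>"
      using Q(1,2) finW by (intro card_Union_disjoint) (auto intro: finite_subset)
    ultimately show ?thesis by (simp add: union_Q)
  qed
  moreover have "card W = card V - card O\<^sub>I"
    unfolding W_def using OV finite_V finite_subset by (intro card_Diff_subset) auto
  moreover have "card (M - I) = card M - card I"
    using finI IM by (intro card_Diff_subset) auto
  ultimately have "card \<Q> = card (M - I)" using card card_O by simp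
  then obtain h where h: "bij_betw h (M - I) \<Q>"
    using fin finQ by (metis finite_Diff finite_same_card_bij)
  define f where "f i = (if i \<in> I then a i else (SOME x. x \<in> h i))" for i
  define P where "P i = {f i, f i + d i}" for i
  have P_I: "P i = {a i, a i + c i + u}" if "i \<in> I" for i
    using that d(1) by (simp add: P_def f_def add.assoc)
  have P_h: "P i = h i" if "i \<in> M - I" for i
  proof -
    have hi: "h i \<in> \<Q>" using h that by (auto simp: bij_betw_def)
    then have "h i \<noteq> {}" "coset (h i)" using Q(2) by blast+
    then have "(SOME x. x \<in> h i) \<in> h i" by (simp add: some_in_eq)
    then show ?thesis
      using coset_eq[OF \<open>coset (h i)\<close>] d(2) that by (simp add: P_def f_def)
  qed
  have P_O: "P i \<subseteq> O\<^sub>I" if "i \<in> I" for i using P_I[OF that] union_I that by blast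
  have P_W: "P i \<subseteq> W" if "i \<in> M - I" for i
    using P_h[OF that] Q(2) h that by (auto simp: bij_betw_def)
  have "P i \<inter> P j = {}" if ij: "i \<in> M" "j \<in> M" "i \<noteq> j" for i j
  proof -
    consider "i \<in> I" "j \<in> I" | "i \<in> I" "j \<in> M - I" | "i \<in> M - I" "j \<in> I" | "i \<in> M - I" "j \<in> M - I"
      using ij by blast
    then show ?thesis
    proof cases
      case 1
      have "a i \<noteq> a j" using inj_onD[OF inj] 1 ij by blast
      moreover have "a i + c i \<noteq> a j + c j" using inj_onD[OF inj'] 1 ij by blast
      moreover have "a i \<noteq> a j + c j + u" "a j \<noteq> a i + c i + u" using opp' 1 by blast+
      ultimately show ?thesis unfolding P_I[OF 1(1)] P_I[OF 1(2)] by auto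
    next
      case 2
      then show ?thesis using P_O[of i] P_W[of j] unfolding W_def by blast
    next
      case 3
      then show ?thesis using P_O[of j] P_W[of i] unfolding W_def by blast
    next
      case 4
      then have "h i \<noteq> h j" "h i \<in> \<Q>" "h j \<in> \<Q>"
        using h ij(3) by (auto simp: bij_betw_def dest: inj_onD)
      then show ?thesis using disjointD[OF Q(1)] P_h 4 by simp
    qed
  qed
  then have "disjoint_family_on P M" by (simp add: disjoint_family_on_def)
  moreover have "(\<Union>i\<in>M. P i) = V"
  proof -
    have "(\<Union>i\<in>M. P i) = (\<Union>i\<in>I. P i) \<union> (\<Union>i\<in>M - I. P i)" using IM by blast
    also have "(\<Union>i\<in>I. P i) = O\<^sub>I" using P_I union_I by simp
    also have "(\<Union>i\<in>M - I. P i) = W" using P_h h union_Q by (simp add: bij_betw_def)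
    finally show ?thesis using OV by (auto simp: W_def)
  qed
  moreover have "d i \<noteq> 0" if "i \<in> M" for i
  proof (cases "i \<in> I")
    case True
    then have "f i \<noteq> f i + d i" using opp'[OF True True] d(1) by (simp add: f_def add.assoc)
    then show ?thesis by simp
  qed (use d(2) that u_nonzero in simp)
  then have "\<forall>i\<in>M. f i \<noteq> f i + d i \<and> f i + (f i + d i) = d i"
    by (simp add: double_left)
  ultimately show ?thesis
    unfolding P_def by (intro exI[of _ f] exI[of _ "\<lambda>i. f i + d i"]) simp
qed

end

section \<open>Coordinates and the reserve\<close>

definition cube :: "nat set \<Rightarrow> (nat \<Rightarrow> bit) set" where
  "cube A = {f. \<forall>i. i \<notin> A \<longrightarrow> f i = 0}"

lemma cube_eq: "cube A = (\<lambda>S i. of_bool (i \<in> S)) ` Pow A"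
proof (intro equalityI subsetI)
  fix f assume f: "f \<in> cube A"
  have "f = (\<lambda>i. of_bool (i \<in> {i. f i = 1}))"
  proof
    show "f i = of_bool (i \<in> {i. f i = 1})" for i by (cases "f i") auto
  qed
  moreover have "{i. f i = 1} \<in> Pow A" using f by (auto simp: cube_def)
  ultimately show "f \<in> (\<lambda>S i. of_bool (i \<in> S)) ` Pow A" by blast
qed (auto simp: cube_def)

lemma finite_cube: "finite A \<Longrightarrow> finite (cube A)"
  by (simp add: cube_eq)

lemma card_cube:
  assumes "finite A"
  shows "card (cube A) = 2 ^ card A"
proof -
  have "inj_on (\<lambda>S i. of_bool (i \<in> S) :: bit) (Pow A)"
  proof (rule inj_onI)
    fix S T assume "(\<lambda>i. of_bool (i \<in> S) :: bit) = (\<lambda>i. of_bool (i \<in> T))"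
    then have "(of_bool (i \<in> S) :: bit) = of_bool (i \<in> T)" for i by meson
    then have "i \<in> S \<longleftrightarrow> i \<in> T" for i by (simp only: of_bool_eq_iff)
    then show "S = T" by blast
  qed
  then show ?thesis using assms by (simp add: cube_eq card_image card_Pow)
qed

lemma two_group_cube:
  assumes "finite A" "u \<in> cube A" "u \<noteq> 0"
  shows "two_group (cube A) u"
proof
  show "x + x = 0" for x :: "nat \<Rightarrow> bit" by (simp add: fun_eq_iff)
qed (use assms finite_cube in \<open>auto simp: cube_def\<close>)

text \<open>
  The vectors that vanish on one of four disjoint blocks of \<open>b\<close> coordinates. Its density is at most
  \<open>4 / 2 ^ b\<close>, yet every set of four vectors has a positive proportion of its translates inside.
\<close>

definition reserve :: "nat \<Rightarrow> nat \<Rightarrow> (nat \<Rightarrow> bit) set" where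
  "reserve n b = (\<Union>k<4. cube ({..<n} - {k * b..<(k + 1) * b}))"

lemma reserve_subset: "reserve n b \<subseteq> cube {..<n}"
  by (auto simp: reserve_def cube_def)

lemma card_reserve_le:
  assumes "4 * b \<le> n"
  shows "card (reserve n b) \<le> 4 * 2 ^ (n - b)"
proof -
  have "card (reserve n b) \<le> (\<Sum>k<4. card (cube ({..<n} - {k * b..<(k + 1) * b})))"
    unfolding reserve_def by (rule card_UN_le) simp
  also have "\<dots> = (\<Sum>k<4::nat. 2 ^ (n - b))"
  proof (rule sum.cong)
    fix k :: nat assume "k \<in> {..<4}"
    then have "(k + 1) * b \<le> 4 * b" by (intro mult_le_mono1) simp
    then have "(k + 1) * b \<le> n" using assms by (rule le_trans)
    then have "{k * b..<(k + 1) * b} \<subseteq> {..<n}"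
      unfolding lessThan_atLeast0 by (intro ivl_subset[THEN iffD2]) simp
    then have "card ({..<n} - {k * b..<(k + 1) * b}) = n - b"
      by (subst card_Diff_subset) auto
    then show "card (cube ({..<n} - {k * b..<(k + 1) * b})) = 2 ^ (n - b)"
      by (simp add: card_cube)
  qed simp
  finally show ?thesis by simp
qed

text \<open>
  The block numbered \<open>h i\<close> is assigned to the index \<open>i\<close>. A translation that agrees with \<open>p i\<close> on
  that block for each \<open>i\<close> is determined on the first \<open>4 * b\<close> coordinates and free on the others.
\<close>

lemma translates_in_reserve:
  fixes p :: "'i \<Rightarrow> nat \<Rightarrow> bit"
  assumes b: "4 * b \<le> n" "b > 0" and g: "card g = 4" and p: "p ` g \<subseteq> cube {..<n}"
  shows "2 ^ (n - 4 * b) \<le> card {x \<in> cube {..<n}. \<forall>i\<in>g. x + p i \<in> reserve n b}"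
proof -
  have "finite g" using g by (metis card.infinite zero_neq_numeral)
  then obtain h where h: "bij_betw h g {0..<4::nat}"
    using g ex_bij_betw_finite_nat by metis
  define q where "q = (\<lambda>t. if t < 4 * b then p (the_inv_into g h (t div b)) t else 0)"
  have q_eq: "q t = p i t" if "i \<in> g" "t \<in> {h i * b..<(h i + 1) * b}" for i t
  proof -
    have "h i < 4" using h that(1) by (auto simp: bij_betw_def)
    then have "(h i + 1) * b \<le> 4 * b" by (intro mult_le_mono1) simp
    then have "t < 4 * b" using that(2) unfolding atLeastLessThan_iff by linarith
    moreover have "t div b = h i"
      using that(2) by (intro div_nat_eqI) (auto simp: mult.commute)
    moreover have "the_inv_into g h (h i) = i"
      using h that(1) by (intro the_inv_into_f_f) (auto simp: bij_betw_def)
    ultimately show ?thesis by (simp add: q_def)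
  qed
  have qV: "q \<in> cube {..<n}" using b by (auto simp: q_def cube_def)
  have "(\<lambda>y. q + y) ` cube {4 * b..<n} \<subseteq> {x \<in> cube {..<n}. \<forall>i\<in>g. x + p i \<in> reserve n b}"
  proof (intro subsetI CollectI conjI ballI; elim imageE)
    fix x y assume x: "x = q + y" and y: "y \<in> cube {4 * b..<n}"
    show "x \<in> cube {..<n}" using x y qV by (auto simp: cube_def)
    fix i assume i: "i \<in> g"
    have hi: "h i < 4" using h i by (auto simp: bij_betw_def)
    then have le: "(h i + 1) * b \<le> 4 * b" by (intro mult_le_mono1) simp
    have "x + p i \<in> cube ({..<n} - {h i * b..<(h i + 1) * b})"
      unfolding cube_def
    proof (intro CollectI allI impI)
      fix t assume t: "t \<notin> {..<n} - {h i * b..<(h i + 1) * b}"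
      show "(x + p i) t = 0"
      proof (cases "t < n")
        case True
        then have tb: "t \<in> {h i * b..<(h i + 1) * b}" using t by simp
        then have "t < 4 * b" using le unfolding atLeastLessThan_iff by linarith
        then have "y t = 0" using y by (simp add: cube_def)
        then show ?thesis using q_eq[OF i tb] by (simp add: x)
      next
        case False
        then have "q t = 0" "y t = 0" "p i t = 0" using qV y p i by (auto simp: cube_def)
        then show ?thesis by (simp add: x)
      qed
    qed
    then show "x + p i \<in> reserve n b" unfolding reserve_def using hi by blast
  qed
  then have "card ((\<lambda>y. q + y) ` cube {4 * b..<n}) \<le> card {x \<in> cube {..<n}. \<forall>i\<in>g. x + p i \<in> reserve n b}"
    by (intro card_mono) (simp_all add: finite_cube)
  moreover have "card ((\<lambda>y. q + y) ` cube {4 * b..<n}) = 2 ^ (n - 4 * b)"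
    by (subst card_image) (simp_all add: card_cube inj_on_def)
  ultimately show ?thesis by simp
qed

text \<open>
  The leftover proportion is \<open>\<delta> = 1 / (16 * 2 ^ (4 * b))\<close>, which uses up half of the
  \<open>2 ^ n / 2 ^ (4 * b)\<close> translates available in the reserve. The conditions on \<open>n\<close> make the dense
  stage possible for this \<open>\<delta>\<close>, and keep the rest of at most \<open>2 * sqrt (2 ^ n)\<close> shifts small against
  the greedy bound for walks of length \<open>n + 1\<close> and against the other half of the reserve.
\<close>

lemma pairing_cube:
  fixes d :: "'i \<Rightarrow> nat \<Rightarrow> bit" and \<epsilon> :: real
  assumes \<epsilon>: "\<epsilon> > 0" and b: "4 * b \<le> n" "b > 0" "16 \<le> \<epsilon> * 2 ^ b" and n: "2 \<le> n"
    and large: "5 < \<epsilon>\<^sup>2 * (1 / (16 * 2 ^ (4 * b)))\<^sup>2 * 2 ^ n"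
    and sparse: "(real n + 1) * (4 * sqrt (2 ^ n)) < 2 ^ n"
      "144 * sqrt (2 ^ n) < 2 ^ n / (2 * 2 ^ (4 * b))"
    and M: "finite M" "card M = 2 ^ (n - 1)"
    and d: "\<forall>i\<in>M. d i \<in> cube {..<n} \<and> d i \<noteq> 0" "sum d M = 0"
    and u: "real (card {i\<in>M. d i = u}) \<ge> (1/2 + \<epsilon>) * card M"
  shows "\<exists>a b. (\<forall>i\<in>M. a i \<noteq> b i \<and> a i + b i = d i) \<and>
           disjoint_family_on (\<lambda>i. {a i, b i}) M \<and> (\<Union>i\<in>M. {a i, b i}) = cube {..<n}"
proof -
  define V where "V = cube {..<n}"
  have card_V: "card V = 2 ^ n" by (simp add: V_def card_cube)
  have VM: "card V = 2 * card M" using n by (simp add: card_V M(2) power_eq_if)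
  have M_pos: "card M > 0" using M by simp
  have "{i\<in>M. d i = u} \<noteq> {}"
  proof
    assume "{i\<in>M. d i = u} = {}"
    then have "(1/2 + \<epsilon>) * card M \<le> 0" using u by (simp only: card.empty of_nat_0)
    then show False using \<epsilon> M_pos by (simp add: mult_le_0_iff)
  qed
  then have uV: "u \<in> V" "u \<noteq> 0" using d(1) by (auto simp: V_def)
  interpret two_group V u
    unfolding V_def using uV by (intro two_group_cube) (auto simp: V_def)
  define I where "I = {i\<in>M. d i \<noteq> u}"
  define c where "c i = d i + u" for i
  have IM: "I \<subseteq> M" "finite I" using M(1) by (auto simp: I_def)
  have "{i\<in>M. d i = u} = M - I" by (auto simp: I_def)
  then have card_MI: "real (card M) - real (card I) \<ge> (1/2 + \<epsilon>) * card M"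
    using u card_Diff_subset[OF IM(2,1)] card_mono[OF M(1) IM(1)] by (simp add: of_nat_diff)
  \<comment> \<open>the number of indices is even, so adding \<open>u\<close> to every difference keeps the sum zero\<close>
  have "sum c I = 0"
  proof -
    have "sum c M = sum d M + sum (\<lambda>_. u) M" by (simp add: c_def sum.distrib)
    also have "sum (\<lambda>_. u) M = 0"
      using n by (intro sum_constant_even) (simp add: M(2))
    finally have "sum c M = 0" unfolding d(2) by (simp only: add_0)
    moreover have "sum c M = sum c I"
      using M(1) by (intro sum.mono_neutral_right) (auto simp: I_def c_def double)
    ultimately show ?thesis by simp
  qed
  moreover have "c ` I \<subseteq> V" using d(1) uV(1) add_V by (auto simp: I_def c_def V_def)
  moreover have "\<forall>i\<in>I. c i \<noteq> 0 \<and> c i \<noteq> u"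
    using d(1) by (auto simp: I_def c_def add_eq_iff double)
  moreover have "2 * card I + 2 * card (reserve n b) \<le> (1/2 - \<epsilon>/2) * card V"
  proof -
    have "real (card (reserve n b)) \<le> real (4 * 2 ^ (n - b))"
      using card_reserve_le[OF b(1)] by (rule of_nat_mono)
    also have "\<dots> = 4 * (2 ^ n / 2 ^ b)"
      using b power_diff[of "2::real" b n] by simp
    also have "\<dots> \<le> 4 * (\<epsilon> / 16 * 2 ^ n)"
      using b(3) by (simp add: field_simps)
    finally have "2 * real (card (reserve n b)) \<le> \<epsilon> / 2 * card V" by (simp add: card_V)
    moreover have "2 * real (card I) \<le> (1/2 - \<epsilon>) * card V"
      using card_MI VM by (simp add: algebra_simps)
    ultimately show ?thesis by (simp add: algebra_simps)
  qed
  moreover have L_bound: "(n + 1) * (2 * t) < card V \<and>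
      72 * real t + 8 * (1 / (16 * 2 ^ (4 * b))) * card V < real (2 ^ (n - 4 * b))"
    if "t * t \<le> 4 * card V" for t
  proof -
    have "real (t * t) \<le> real (4 * card V)" using that by (rule of_nat_mono)
    then have "(real t)\<^sup>2 \<le> 4 * 2 ^ n" by (simp add: card_V power2_eq_square)
    then have "real t \<le> sqrt (4 * 2 ^ n)" by (rule real_le_rsqrt)
    then have t: "real t \<le> 2 * sqrt (2 ^ n)" by (simp add: real_sqrt_mult)
    have "real ((n + 1) * (2 * t)) = (real n + 1) * (2 * real t)"
      unfolding of_nat_mult of_nat_add by simp
    also have "\<dots> \<le> (real n + 1) * (4 * sqrt (2 ^ n))" using t by (intro mult_left_mono) auto
    also have "\<dots> < real (card V)" using sparse(1) by (simp add: card_V)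
    finally have "(n + 1) * (2 * t) < card V" by (simp only: of_nat_less_iff)
    moreover have "real (2 ^ (n - 4 * b)) = 2 ^ n / 2 ^ (4 * b)"
      using b(1) power_diff[of "2::real" "4 * b" n] by simp
    ultimately show ?thesis using t sparse(2) by (simp add: card_V)
  qed
  moreover have "5 < 4 * (\<epsilon>/2)\<^sup>2 * (1 / (16 * 2 ^ (4 * b)))\<^sup>2 * card V"
    using large by (simp add: card_V power_divide)
  moreover have "card V < 2 ^ (n + 1)" by (simp add: card_V)
  ultimately have "\<exists>a \<G>. packing c a \<G> \<and> \<Union>\<G> = I"
    using \<epsilon> by (intro packing_exists[OF IM(2) _ _ _ _ _ _ _ _ _ _ L_bound])
      (use reserve_subset translates_in_reserve[OF b(1,2)] in \<open>simp_all add: V_def\<close>)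
  then obtain a \<G> where "packing c a \<G>" "\<Union>\<G> = I" by blast
  moreover have "\<forall>i\<in>I. d i = c i + u" by (simp add: c_def add.assoc double)
  moreover have "\<forall>i\<in>M - I. d i = u" by (simp add: I_def)
  ultimately show ?thesis
    using pairing_of_packing[OF M(1) VM[symmetric] IM(1)] unfolding V_def by blast
qed


section \<open>Transfer to vectors\<close>

lemma eventually_large:
  fixes A B :: real
  assumes "A > 0" "B > 0"
  shows "\<forall>\<^sub>F n in sequentially. (real n + 1) * (4 * sqrt (2 ^ n)) < 2 ^ n \<and>
           144 * sqrt (2 ^ n) < 2 ^ n * A \<and> 5 < 2 ^ n * B"
  using assms by (intro eventually_conj; real_asymp)

definition coordinates :: "nat \<Rightarrow> bit vec \<Rightarrow> nat \<Rightarrow> bit" where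
  "coordinates n v = (\<lambda>j. if j < n then v $ j else 0)"

lemma vec_coordinates: "v \<in> carrier_vec n \<Longrightarrow> vec n (coordinates n v) = v"
  by (auto simp: coordinates_def)

lemma coordinates_vec: "f \<in> cube {..<n} \<Longrightarrow> coordinates n (vec n f) = f"
  by (auto simp: coordinates_def cube_def)

lemma coordinates_in_cube: "coordinates n v \<in> cube {..<n}"
  by (auto simp: coordinates_def cube_def)

lemma vec_image_cube: "vec n ` cube {..<n} = (carrier_vec n :: bit vec set)"
proof
  show "(carrier_vec n :: bit vec set) \<subseteq> vec n ` cube {..<n}"
    using vec_coordinates coordinates_in_cube by (metis image_eqI subsetI)
qed auto

lemma inj_on_vec_cube: "inj_on (vec n) (cube {..<n})"
  using coordinates_vec by (rule inj_on_inverseI)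

lemma sum_fun_apply: "(\<Sum>i\<in>A. f i) x = (\<Sum>i\<in>A. f i x)"
  for f :: "'i \<Rightarrow> 'b \<Rightarrow> 'c::comm_monoid_add"
  by (induction A rule: infinite_finite_induct) simp_all

theorem theorem1p9:
  fixes \<epsilon> :: real
  assumes "\<epsilon> > 0"
  shows "\<exists>n0::nat. n0 \<ge> 2 \<and>
    (\<forall>n\<ge>n0. \<forall>(m::nat) (d :: nat \<Rightarrow> bit vec).
       m = 2 ^ (n - 1) \<longrightarrow>
       (\<forall>i\<in>{1..m}. d i \<in> carrier_vec n \<and> d i \<noteq> 0\<^sub>v n) \<longrightarrow>
       finsum_vec TYPE(bit) n d {1..m} = 0\<^sub>v n \<longrightarrow>
       (\<exists>u\<in>carrier_vec n. real (card {i\<in>{1..m}. d i = u}) \<ge> (1/2 + \<epsilon>) * real m) \<longrightarrow>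
       (\<exists>a b :: nat \<Rightarrow> bit vec.
          (\<forall>i\<in>{1..m}. a i \<noteq> b i) \<and>
          disjoint_family_on (\<lambda>i. {a i, b i}) {1..m} \<and>
          (\<Union>i\<in>{1..m}. {a i, b i}) = carrier_vec n \<and>
          (\<forall>i\<in>{1..m}. a i - b i = d i)))"
proof -
  \<comment> \<open>the block length is chosen so that the reserve has density at most \<open>\<epsilon> / 4\<close>\<close>
  obtain b\<^sub>0 where b0: "16 / \<epsilon> < 2 ^ b\<^sub>0" using real_arch_pow[of 2 "16 / \<epsilon>"] by auto
  define b where "b = Suc b\<^sub>0"
  have "16 / \<epsilon> \<le> 2 * 2 ^ b\<^sub>0" using b0 zero_less_power[of "2::real" b\<^sub>0] by linarith
  then have "16 / \<epsilon> \<le> 2 ^ b" by (simp add: b_def)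
  then have b: "b > 0" "16 \<le> \<epsilon> * 2 ^ b"
    using assms by (simp_all add: b_def field_simps)
  define \<gamma> :: real where "\<gamma> = 1 / 2 ^ (4 * b)"
  have "\<gamma> > 0" by (simp add: \<gamma>_def)
  then obtain n1 where n1: "\<And>n. n \<ge> n1 \<Longrightarrow> (real n + 1) * (4 * sqrt (2 ^ n)) < 2 ^ n \<and>
      144 * sqrt (2 ^ n) < 2 ^ n * (\<gamma> / 2) \<and> 5 < 2 ^ n * (\<epsilon>\<^sup>2 * (\<gamma> / 16)\<^sup>2)"
    using eventually_large[of "\<gamma> / 2" "\<epsilon>\<^sup>2 * (\<gamma> / 16)\<^sup>2"] assms
    unfolding eventually_sequentially by auto
  show ?thesis
  proof (intro exI[of _ "max 2 (max (4 * b) n1)"] conjI allI impI)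
    fix n m :: nat and d :: "nat \<Rightarrow> bit vec"
    assume n: "n \<ge> max 2 (max (4 * b) n1)" and m: "m = 2 ^ (n - 1)"
      and d: "\<forall>i\<in>{1..m}. d i \<in> carrier_vec n \<and> d i \<noteq> 0\<^sub>v n"
      and zero_sum: "finsum_vec TYPE(bit) n d {1..m} = 0\<^sub>v n"
      and "\<exists>u\<in>carrier_vec n. real (card {i\<in>{1..m}. d i = u}) \<ge> (1/2 + \<epsilon>) * real m"
    then obtain u where u: "u \<in> carrier_vec n"
      "real (card {i\<in>{1..m}. d i = u}) \<ge> (1/2 + \<epsilon>) * real m" by blast
    define D where "D i = coordinates n (d i)" for i
    have vec_D: "vec n (D i) = d i" if "i \<in> {1..m}" for i
      using d that vec_coordinates unfolding D_def by blast
    have vec_0: "vec n (0 :: nat \<Rightarrow> bit) = 0\<^sub>v n" by auto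
    have D_cube: "\<forall>i\<in>{1..m}. D i \<in> cube {..<n} \<and> D i \<noteq> 0"
      using d vec_D vec_0 coordinates_in_cube unfolding D_def by metis
    have D_sum: "(\<Sum>i\<in>{1..m}. D i) = 0"
    proof
      fix j
      show "(\<Sum>i\<in>{1..m}. D i) j = 0 j"
      proof (cases "j < n")
        case True
        have "(\<Sum>i\<in>{1..m}. d i $ j) = finsum_vec TYPE(bit) n d {1..m} $ j"
          using d True by (intro index_finsum_vec[symmetric]) auto
        then show ?thesis using True zero_sum by (simp add: sum_fun_apply D_def coordinates_def)
      qed (simp add: sum_fun_apply D_def coordinates_def)
    qed
    have "{i\<in>{1..m}. D i = coordinates n u} = {i\<in>{1..m}. d i = u}"
      using vec_D vec_coordinates[OF u(1)] unfolding D_def by (metis (lifting))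
    then have D_u: "real (card {i\<in>{1..m}. D i = coordinates n u}) \<ge> (1/2 + \<epsilon>) * card {1..m}"
      using u(2) by simp
    have n_le: "4 * b \<le> n" "2 \<le> n" and card: "card {1..m} = 2 ^ (n - 1)"
      using n m by simp_all
    have large: "5 < \<epsilon>\<^sup>2 * (1 / (16 * 2 ^ (4 * b)))\<^sup>2 * 2 ^ n"
      and sparse: "(real n + 1) * (4 * sqrt (2 ^ n)) < 2 ^ n"
        "144 * sqrt (2 ^ n) < 2 ^ n / (2 * 2 ^ (4 * b))"
      using n1[of n] n by (simp_all add: \<gamma>_def mult_ac)
    note pairing_cube[OF assms n_le(1) b n_le(2) large sparse finite_atLeastAtMost card
        D_cube D_sum D_u]
    then obtain a b' where ab: "\<forall>i\<in>{1..m}. a i \<noteq> b' i \<and> a i + b' i = D i"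
      "disjoint_family_on (\<lambda>i. {a i, b' i}) {1..m}" "(\<Union>i\<in>{1..m}. {a i, b' i}) = cube {..<n}"
      by blast
    have in_cube: "{a i, b' i} \<subseteq> cube {..<n}" if "i \<in> {1..m}" for i using ab(3) that by blast
    have image: "{vec n (a i), vec n (b' i)} = vec n ` {a i, b' i}" for i by simp
    show "\<exists>a b :: nat \<Rightarrow> bit vec. (\<forall>i\<in>{1..m}. a i \<noteq> b i) \<and>
        disjoint_family_on (\<lambda>i. {a i, b i}) {1..m} \<and>
        (\<Union>i\<in>{1..m}. {a i, b i}) = carrier_vec n \<and> (\<forall>i\<in>{1..m}. a i - b i = d i)"
    proof (rule exI[of _ "\<lambda>i. vec n (a i)"], rule exI[of _ "\<lambda>i. vec n (b' i)"],
        intro conjI ballI)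
      fix i assume i: "i \<in> {1..m}"
      show "vec n (a i) \<noteq> vec n (b' i)"
        using inj_onD[OF inj_on_vec_cube, of n "a i" "b' i"] in_cube[OF i] ab(1) i by auto
      have "vec n (a i) - vec n (b' i) = vec n (D i)"
      proof (intro eq_vecI)
        fix j assume "j < dim_vec (vec n (D i))"
        moreover have "(a i + b' i) j = D i j" using ab(1) i by simp
        ultimately show "(vec n (a i) - vec n (b' i)) $ j = vec n (D i) $ j" by simp
      qed simp
      then show "vec n (a i) - vec n (b' i) = d i" using vec_D[OF i] by simp
    next
      show "disjoint_family_on (\<lambda>i. {vec n (a i), vec n (b' i)}) {1..m}"
        unfolding image disjoint_family_on_def
      proof (intro ballI impI)
        fix i j assume ij: "i \<in> {1..m}" "j \<in> {1..m}" "i \<noteq> j"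
        then have "{a i, b' i} \<inter> {a j, b' j} = {}" using ab(2) by (rule_tac disjoint_family_onD)
        then show "vec n ` {a i, b' i} \<inter> vec n ` {a j, b' j} = {}"
          using inj_on_image_Int[OF inj_on_vec_cube in_cube[OF ij(1)] in_cube[OF ij(2)]] by simp
      qed
      show "(\<Union>i\<in>{1..m}. {vec n (a i), vec n (b' i)}) = carrier_vec n"
        unfolding image image_UN[symmetric] ab(3) by (rule vec_image_cube)
    qed
  qed simp
qed

end
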